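(* For all integers $n,r,d\ge 1$, \[ g(n;d)=\sum_{\pi\in S_d}\operatorname{sgn}(\pi)\,\bigl|W'(d,2rn;T(\pi))\bigr| , \] where the sum runs over all permutations $\pi$ of $[d]$.
   Context: Fix integers $n,r\ge 1$ and let $m=rn$. Let $U=\{u_1,\dots,u_n\}$ and $V=\{v_1,\dots,v_n\}$ be disjoint sets, totally ordered by $u_1\prec\cdots\prec u_n$ and $v_1\prec\cdots\prec v_n$. An $r$-regular bipartite multigraph on $(U,V)$ is a multiset of edges $uv$ ($u\in U$, $v\in V$) in which every vertex has degree $r$ (equivalently, an $n\times n$ matrix of nonnegative integers, the multiplicities, with all row and column sums equal to $r$). Two edges $uv,u'v'$ are noncrossing if ($u\prec u'$ and $v\prec v'$) or ($u'\prec u$ and $v'\prec v$). A planar matching is a set of pairwise noncrossing edges; $L(G)$ is the maximum number of edges of a planar matching of $G$. $g(n;d)$ is the number of $r$-regular bipartite multigraphs $G$ on $(U,V)$ with $L(G)\le d$. Walks: a walk of length $2m$ in $\mathbb Z^d$ starting at the origin whose first $m$ steps are positive unit steps and last $m$ steps are negative unit steps is written $a_1\cdots a_m\,|\,b_1\cdots b_m$ with $a_i,b_i\in[d]$, meaning the steps are $e_{a_1},\dots,e_{a_m},-e_{b_1},\dots,-e_{b_m}$ ($e_j$ the standard basis vectors). For $P\subseteq\mathbb Z^d$ (or a point), $W^*(d,2m;P)$ is the set of such walks ending in $P$. Positive steps are indexed by $U\times[r]$ and negative steps by $V\times[r]$ via $a_{u_i^s}=a_{r(i-1)+s}$, $b_{v_i^s}=b_{r(i-1)+s}$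 ($i\in[n]$, $s\in[r]$). For a permutation $\pi$ of $[d]$, the Toeplitz point is $T(\pi)=(1-\pi(1),2-\pi(2),\dots,d-\pi(d))$. $W'(d,2m;P)$ is the set of walks in $W^*(d,2m;P)$ with $a_{u^s}\ge a_{u^{s+1}}$ and $b_{v^s}\ge b_{v^{s+1}}$ for all $u\in U$, $v\in V$, $1\le s<r$. *)

theory Defs
  imports "HOL-Combinatorics.Permutations"
begin

text \<open>An r-regular bipartite multigraph on (U,V), U = {u_1..u_n}, V = {v_1..v_n},
  is given by its multiplicity matrix M: M i j = multiplicity of edge u_i v_j
  (indices in {1..n}; M vanishes outside).\<close>
definition regular_multigraph :: "nat \<Rightarrow> nat \<Rightarrow> (nat \<Rightarrow> nat \<Rightarrow> nat) \<Rightarrow> bool" where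
  "regular_multigraph r n M \<longleftrightarrow>
     (\<forall>i j. M i j \<noteq> 0 \<longrightarrow> i \<in> {1..n} \<and> j \<in> {1..n}) \<and>
     (\<forall>i\<in>{1..n}. (\<Sum>j=1..n. M i j) = r) \<and>
     (\<forall>j\<in>{1..n}. (\<Sum>i=1..n. M i j) = r)"

definition noncrossing :: "nat \<times> nat \<Rightarrow> nat \<times> nat \<Rightarrow> bool" where
  "noncrossing e e' \<longleftrightarrow>
     (fst e < fst e' \<and> snd e < snd e') \<or> (fst e' < fst e \<and> snd e' < snd e)"

definition planar_matching :: "(nat \<Rightarrow> nat \<Rightarrow> nat) \<Rightarrow> (nat \<times> nat) set \<Rightarrow> bool" where
  "planar_matching M S \<longleftrightarrow>
     S \<subseteq> {(i, j). M i j > 0} \<and> (\<forall>e\<in>S. \<forall>e'\<in>S. e \<noteq> e' \<longrightarrow> noncrossing e e')"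

definition L :: "(nat \<Rightarrow> nat \<Rightarrow> nat) \<Rightarrow> nat" where
  "L M = Max (card ` {S. planar_matching M S})"

definition g :: "nat \<Rightarrow> nat \<Rightarrow> nat \<Rightarrow> nat" where
  "g r n d = card {M. regular_multigraph r n M \<and> L M \<le> d}"

text \<open>Walks a_1..a_m | b_1..b_m with m = r n, encoded as lists (a_k = a ! (k-1)),
  entries in [d]; endpoint coordinate j is #{k. a_k = j} - #{k. b_k = j}.
  W' additionally requires a_{u_i^s} \<ge> a_{u_i^{s+1}}, same for b.\<close>
definition Wprime :: "nat \<Rightarrow> nat \<Rightarrow> nat \<Rightarrow> (nat \<Rightarrow> int) \<Rightarrow> (nat list \<times> nat list) set" where
  "Wprime r n d P = {(a, b).
     length a = r * n \<and> length b = r * n \<and> set a \<subseteq> {1..d} \<and> set b \<subseteq> {1..d} \<and>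
     (\<forall>j\<in>{1..d}. int (count_list a j) - int (count_list b j) = P j) \<and>
     (\<forall>i\<in>{1..n}. \<forall>s\<in>{1..<r}.
        a ! (r * (i - 1) + s - 1) \<ge> a ! (r * (i - 1) + s) \<and>
        b ! (r * (i - 1) + s - 1) \<ge> b ! (r * (i - 1) + s))}"

definition toeplitz :: "(nat \<Rightarrow> nat) \<Rightarrow> nat \<Rightarrow> int" where
  "toeplitz \<pi> j = int j - int (\<pi> j)"

end

theory Submission
  imports Defs
begin

text \<open>
  Both sides equal \<open>\<Sum>\<^sub>\<lambda> K\<^sub>\<lambda>\<^sup>2\<close>, where \<open>\<lambda>\<close> runs over the partitions with at most \<open>d\<close> parts and
  \<open>K\<^sub>\<lambda>\<close> is the Kostka number of shape \<open>\<lambda>\<close> and content \<open>(r, \<dots>, r)\<close>.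

  For the left-hand side, RSK is described by a piecewise linear growth rule for interlacing
  partitions. The first parts are last passage times of the matrix; the remaining parts are
  the shapes of the shadow matrix formed from these last passage times (Viennot). Passing
  to the shadow shortens the longest strictly descending chain of nonzero entries by exactly
  one, so after reversing the order of the columns \<open>L(G) \<le> d\<close> says that the shape has at most
  \<open>d\<close> parts.

  For the right-hand side, let \<open>w(x)\<close> be the number of block words with content \<open>x\<close>, which is
  symmetric in \<open>x\<close>, and let \<open>A(y) = \<Sum>\<^sub>\<sigma> sgn(\<sigma>) w(y + \<sigma>)\<close>. Then \<open>A\<close> is antisymmetric, the signed
  walk count is \<open>\<Sum>\<^sub>z w(z + id) A(z) = \<Sum>\<^sub>y A(y)\<^sup>2\<close> with \<open>y\<close> strictly decreasing, and \<open>A\<close> satisfies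
  the Pieri recursion of the Kostka numbers because the steps violating interlacing cancel in
  pairs under an adjacent transposition.
\<close>

section \<open>Last passage times and shadows\<close>

fun lpp :: "(nat \<Rightarrow> nat \<Rightarrow> nat) \<Rightarrow> nat \<Rightarrow> nat \<Rightarrow> nat" where
  "lpp m 0 j = 0"
| "lpp m (Suc i) 0 = 0"
| "lpp m (Suc i) (Suc j) = m (Suc i) (Suc j) + max (lpp m i (Suc j)) (lpp m (Suc i) j)"

text \<open>Viennot's shadow: the mass that a cell passes on to the next part of the shape. By
  monotonicity of \<open>lpp\<close> the subtraction never truncates.\<close>

definition shadow :: "(nat \<Rightarrow> nat \<Rightarrow> nat) \<Rightarrow> nat \<Rightarrow> nat \<Rightarrow> nat" where
  "shadow m i j = (if i = 0 \<or> j = 0 then 0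
     else min (lpp m (i - 1) j) (lpp m i (j - 1)) - lpp m (i - 1) (j - 1))"

lemma lpp_0_right [simp]: "lpp m i 0 = 0"
  by (cases i) auto

lemma lpp_le_Suc_left: "lpp m i j \<le> lpp m (Suc i) j"
  by (cases j) auto

lemma lpp_le_Suc_right: "lpp m i j \<le> lpp m i (Suc j)"
  by (cases i) auto

lemma lpp_mono: "i \<le> i' \<Longrightarrow> j \<le> j' \<Longrightarrow> lpp m i j \<le> lpp m i' j'"
  by (rule order_trans[of _ "lpp m i' j"])
    (auto intro: lift_Suc_mono_le[of "\<lambda>i. lpp m i j"] lift_Suc_mono_le[of "\<lambda>j. lpp m i' j"]
      lpp_le_Suc_left lpp_le_Suc_right)

lemma shadow_Suc_Suc:
  "shadow m (Suc i) (Suc j) = min (lpp m i (Suc j)) (lpp m (Suc i) j) - lpp m i j"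
  by (simp add: shadow_def)

lemma shadow_0 [simp]: "shadow m 0 j = 0" "shadow m i 0 = 0"
  by (simp_all add: shadow_def)

text \<open>A path collects nothing inside the rectangle, so only the best value with which it can
  enter, through column \<open>j\<close> or through row \<open>i\<close>, matters.\<close>

lemma lpp_empty_rectangle:
  assumes "\<And>a b. i < a \<Longrightarrow> a \<le> i2 \<Longrightarrow> j < b \<Longrightarrow> b \<le> j2 \<Longrightarrow> m a b = 0"
    and "i \<le> a" "a \<le> i2" "j \<le> b" "b \<le> j2"
  shows "lpp m a b = max (lpp m a j) (lpp m i b)"
  using assms(2-)
proof (induction "a + b" arbitrary: a b rule: less_induct)
  case less
  show ?case
  proof (cases "a = i \<or> b = j")
    case True
    with less.prems lpp_mono[of i i j b m] lpp_mono[of i a j j m] show ?thesis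
      by auto
  next
    case False
    then obtain a' b' where ab: "a = Suc a'" "b = Suc b'" "i \<le> a'" "j \<le> b'"
      using less.prems by (cases a; cases b; auto)
    have "lpp m a' b = max (lpp m a' j) (lpp m i b)" "lpp m a b' = max (lpp m a j) (lpp m i b')"
      using ab less.prems by (auto intro!: less.hyps)
    moreover have "m a b = 0" using assms(1) ab less.prems by auto
    moreover have "lpp m a' j \<le> lpp m a j" "lpp m i b' \<le> lpp m i b"
      using ab by (auto intro: lpp_mono)
    ultimately show ?thesis using ab by auto
  qed
qed

text \<open>Dual to the previous lemma: a vanishing shadow makes \<open>lpp\<close> at a cell equal
  to the smaller of its values one row further and one column further, so the values propagate
  backwards from the far sides \<open>i2\<close> and \<open>j2\<close>.\<close>

lemma lpp_empty_shadow_rectangle: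
  assumes "\<And>a b. i < a \<Longrightarrow> a \<le> i2 \<Longrightarrow> j < b \<Longrightarrow> b \<le> j2 \<Longrightarrow> shadow m a b = 0"
    and "i \<le> a" "a \<le> i2" "j \<le> b" "b \<le> j2"
  shows "lpp m a b = min (lpp m a j2) (lpp m i2 b)"
  using assms(2-)
proof (induction "(i2 - a) + (j2 - b)" arbitrary: a b rule: less_induct)
  case less
  show ?case
  proof (cases "a = i2 \<or> b = j2")
    case True
    with less.prems lpp_mono[of i2 i2 b j2 m] lpp_mono[of a i2 j2 j2 m] show ?thesis
      by auto
  next
    case False
    have "lpp m (Suc a) b = min (lpp m (Suc a) j2) (lpp m i2 b)"
      "lpp m a (Suc b) = min (lpp m a j2) (lpp m i2 (Suc b))"
      using False less.prems by (auto intro!: less.hyps)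
    moreover have "min (lpp m a (Suc b)) (lpp m (Suc a) b) - lpp m a b = 0"
      using assms(1)[of "Suc a" "Suc b"] False less.prems by (auto simp: shadow_Suc_Suc)
    moreover have "lpp m a j2 \<le> lpp m (Suc a) j2" "lpp m i2 b \<le> lpp m i2 (Suc b)"
      "lpp m a b \<le> lpp m a (Suc b)" "lpp m a b \<le> lpp m (Suc a) b"
      by (auto intro: lpp_mono)
    ultimately show ?thesis by auto
  qed
qed

section \<open>Descending chains in a matrix and in its shadow\<close>

definition descending_chain :: "(nat \<Rightarrow> nat \<Rightarrow> nat) \<Rightarrow> nat \<Rightarrow> bool" where
  "descending_chain m k \<longleftrightarrow> (\<exists>i j. (\<forall>t<k. 0 < m (i t) (j t)) \<and>
     (\<forall>t. Suc t < k \<longrightarrow> i t < i (Suc t) \<and> j (Suc t) < j t))"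

lemma shadow_pos:
  assumes "0 < shadow m i j"
  obtains "0 < i" "0 < j" "lpp m (i - 1) (j - 1) < lpp m (i - 1) j"
    "lpp m (i - 1) (j - 1) < lpp m i (j - 1)"
  using assms by (auto simp: shadow_def split: if_splits)

lemma entry_pos_imp_lpp_less:
  assumes "0 < m i j" "0 < i" "0 < j"
  shows "lpp m (i - 1) j < lpp m i j" "lpp m i (j - 1) < lpp m i j"
  using assms by (cases i; cases j; auto)+

text \<open>At a shadow cell \<open>lpp\<close> rises in both directions. If the region between the
  two cells were empty, the rise at the first would already be reached in column
  \<open>j' - 1\<close> and the rise at the second in row \<open>i - 1\<close>; monotonicity then
  closes a cycle of strict inequalities.\<close>

lemma entry_between_shadows:
  assumes "0 < shadow m i j" "0 < shadow m i' j'" "i < i'" "j' < j"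
  shows "\<exists>a b. 0 < m a b \<and> i \<le> a \<and> a < i' \<and> j' \<le> b \<and> b < j"
proof (rule ccontr)
  assume none: "\<not> ?thesis"
  have empty: "m a b = 0" if "i - 1 < a" "a \<le> i' - 1" "j' - 1 < b" "b \<le> j - 1" for a b
  proof -
    have "i \<le> a" "a < i'" "j' \<le> b" "b < j" using that assms(3,4) by linarith+
    with none show ?thesis using neq0_conv[of "m a b"] by blast
  qed
  have rect: "lpp m a b = max (lpp m a (j' - 1)) (lpp m (i - 1) b)"
    if "i - 1 \<le> a" "a \<le> i' - 1" "j' - 1 \<le> b" "b \<le> j - 1" for a b
    by (rule lpp_empty_rectangle[OF empty]) (use that in auto)
  obtain p: "0 < i" "0 < j" "lpp m (i - 1) (j - 1) < lpp m i (j - 1)"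
    using assms(1) by (rule shadow_pos)
  obtain p': "0 < i'" "0 < j'" "lpp m (i' - 1) (j' - 1) < lpp m (i' - 1) j'"
    using assms(2) by (rule shadow_pos)
  have "lpp m (i - 1) (j - 1) < lpp m i (j' - 1)"
    using rect[of i "j - 1"] p assms by auto
  also have "\<dots> \<le> lpp m (i' - 1) (j' - 1)"
    using assms by (intro lpp_mono) auto
  also have "\<dots> < lpp m (i - 1) j'"
    using rect[of "i' - 1" j'] p' assms by auto
  also have "\<dots> \<le> lpp m (i - 1) (j - 1)"
    using assms by (intro lpp_mono) auto
  finally show False by simp
qed

text \<open>An end case of \<open>entry_between_shadows\<close>: \<open>lpp\<close> is zero on the
  boundary, so the rise at a shadow cell has to come from an entry. This lemma and the next one
  supply the two ends of a chain.\<close>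

lemma entry_above_shadow:
  assumes "0 < shadow m i j"
  shows "\<exists>a b. 0 < m a b \<and> a < i \<and> j \<le> b"
proof (rule ccontr)
  assume none: "\<not> ?thesis"
  have empty: "m a b = 0" if "0 < a" "a \<le> i - 1" "j - 1 < b" "b \<le> j" for a b
  proof -
    have "a < i" "j \<le> b" using that by linarith+
    with none show ?thesis using neq0_conv[of "m a b"] by blast
  qed
  obtain p: "0 < i" "0 < j" "lpp m (i - 1) (j - 1) < lpp m (i - 1) j"
    using assms by (rule shadow_pos)
  then show False
    using lpp_empty_rectangle[of 0 "i - 1" "j - 1" j m "i - 1" j, OF empty] by auto
qed

lemma entry_left_of_shadow:
  assumes "0 < shadow m i j"
  shows "\<exists>a b. 0 < m a b \<and> i \<le> a \<and> b < j"
proof (rule ccontr)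
  assume none: "\<not> ?thesis"
  have empty: "m a b = 0" if "i - 1 < a" "a \<le> i" "0 < b" "b \<le> j - 1" for a b
  proof -
    have "i \<le> a" "b < j" using that by linarith+
    with none show ?thesis using neq0_conv[of "m a b"] by blast
  qed
  obtain p: "0 < i" "0 < j" "lpp m (i - 1) (j - 1) < lpp m i (j - 1)"
    using assms by (rule shadow_pos)
  then show False
    using lpp_empty_rectangle[of "i - 1" i 0 "j - 1" m i "j - 1", OF empty] by auto
qed

text \<open>The same cycle of inequalities with the roles exchanged: a positive entry lifts
  \<open>lpp\<close> strictly above both preceding cells, and an empty shadow would express these
  values by minima over the far sides.\<close>

lemma shadow_between_entries:
  assumes "0 < m i j" "0 < m i' j'" "i < i'" "j' < j" "0 < i" "0 < j'"
  shows "\<exists>a b. 0 < shadow m a b \<and> i < a \<and> a \<le> i' \<and> j' < b \<and> b \<le> j"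
proof (rule ccontr)
  assume "\<not> ?thesis"
  then have rect: "lpp m a b = min (lpp m a j) (lpp m i' b)"
    if "i \<le> a" "a \<le> i'" "j' \<le> b" "b \<le> j" for a b
    using lpp_empty_shadow_rectangle[of i i' j' j m a b] that by auto
  have "lpp m i' (j - 1) < lpp m i j"
    using rect[of i "j - 1"] entry_pos_imp_lpp_less[of m i j] assms by auto
  also have "\<dots> \<le> lpp m (i' - 1) j"
    using assms by (intro lpp_mono) auto
  also have "\<dots> < lpp m i' j'"
    using rect[of "i' - 1" j'] entry_pos_imp_lpp_less[of m i' j'] assms by auto
  also have "\<dots> \<le> lpp m i' (j - 1)"
    using assms by (intro lpp_mono) auto
  finally show False by simp
qed

text \<open>There are \<open>k - 1\<close> gaps between the shadow cells, each containing an entry,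
  and two further entries lie outside the ends. For \<open>k = 0\<close> there are no ends, and the
  zero matrix would be a counterexample.\<close>

lemma descending_chain_shadow:
  assumes "descending_chain (shadow m) k" "0 < k"
  shows "descending_chain m (Suc k)"
proof -
  obtain i j where ij: "\<And>t. t < k \<Longrightarrow> 0 < shadow m (i t) (j t)"
    "\<And>t. Suc t < k \<Longrightarrow> i t < i (Suc t) \<and> j (Suc t) < j t"
    using assms(1) unfolding descending_chain_def by auto
  \<comment> \<open>Entry \<open>t\<close> is placed between shadow cells \<open>t - 1\<close> and
    \<open>t\<close>; the condition on a missing neighbour is void at \<open>t = 0\<close> and at
    \<open>t = k\<close>.\<close>
  have "\<exists>a b. 0 < m a b \<and> (\<forall>s. t = Suc s \<longrightarrow> i s \<le> a \<and> b < j s) \<and> (t < k \<longrightarrow> a < i t \<and> j t \<le> b)"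
    if "t \<le> k" for t
  proof (cases t)
    case 0
    with entry_above_shadow[OF ij(1), of t] assms(2) show ?thesis by auto
  next
    case (Suc s)
    show ?thesis
    proof (cases "t < k")
      case True
      with Suc ij(2)[of s] have "i s < i t" "j t < j s" by auto
      with True Suc entry_between_shadows[OF ij(1) ij(1), of s t] show ?thesis by fastforce
    next
      case False
      with Suc that entry_left_of_shadow[OF ij(1), of s] show ?thesis by auto
    qed
  qed
  then obtain a b where ab: "\<And>t. t \<le> k \<Longrightarrow> 0 < m (a t) (b t)"
    "\<And>t. Suc t \<le> k \<Longrightarrow> i t \<le> a (Suc t) \<and> b (Suc t) < j t"
    "\<And>t. t < k \<Longrightarrow> a t < i t \<and> j t \<le> b t"
    by (metis less_imp_le_nat)
  show ?thesis
    unfolding descending_chain_def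
  proof (rule exI[of _ a], rule exI[of _ b], intro conjI allI impI)
    fix t assume "Suc t < Suc k"
    then show "a t < a (Suc t)" "b (Suc t) < b t"
      using ab(2)[of t] ab(3)[of t] by auto
  qed (use ab in auto)
qed

text \<open>Each of the \<open>k\<close> gaps between consecutive entries contains a shadow cell.
  Row and column 0 must be empty because \<open>lpp\<close> does not see entries there.\<close>

lemma descending_chain_imp_shadow:
  assumes "descending_chain m (Suc k)" "\<And>i. m i 0 = 0" "\<And>j. m 0 j = 0"
  shows "descending_chain (shadow m) k"
proof -
  obtain i j where ij: "\<And>t. t \<le> k \<Longrightarrow> 0 < m (i t) (j t)"
    "\<And>t. t < k \<Longrightarrow> i t < i (Suc t) \<and> j (Suc t) < j t"
    using assms(1) unfolding descending_chain_def by (auto simp: less_Suc_eq_le Suc_le_eq)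
  have pos: "0 < i t" "0 < j t" if "t \<le> k" for t
    using ij(1)[OF that] assms(2,3) by (metis neq0_conv)+
  have "\<exists>a b. 0 < shadow m a b \<and> i t < a \<and> a \<le> i (Suc t) \<and> j (Suc t) < b \<and> b \<le> j t"
    if "t < k" for t
    using that ij pos by (intro shadow_between_entries) auto
  then obtain a b where ab: "\<And>t. t < k \<Longrightarrow> 0 < shadow m (a t) (b t) \<and> i t < a t \<and>
      a t \<le> i (Suc t) \<and> j (Suc t) < b t \<and> b t \<le> j t"
    by metis
  show ?thesis
    unfolding descending_chain_def
  proof (rule exI[of _ a], rule exI[of _ b], intro conjI allI impI)
    fix t assume "Suc t < k"
    then show "a t < a (Suc t)" "b (Suc t) < b t"
      using ab[of t] ab[of "Suc t"] by auto
  qed (use ab in auto)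
qed

lemma descending_chain_iff_shadow_power:
  assumes "\<And>i. m i 0 = 0" "\<And>j. m 0 j = 0"
  shows "descending_chain m (Suc k) \<longleftrightarrow> (\<exists>i j. 0 < (shadow ^^ k) m i j)"
  using assms
proof (induction k arbitrary: m)
  case 0
  show ?case unfolding descending_chain_def by auto
next
  case (Suc k)
  have "descending_chain m (Suc (Suc k)) \<longleftrightarrow> descending_chain (shadow m) (Suc k)"
    using descending_chain_shadow descending_chain_imp_shadow Suc.prems by blast
  with Suc.IH[of "shadow m"] show ?case by (simp add: funpow_swap1)
qed

section \<open>Local growth rule\<close>

lemma lpp_cong:
  assumes "\<And>a b. a \<le> i \<Longrightarrow> b \<le> j \<Longrightarrow> m a b = m' a b"
  shows "lpp m i j = lpp m' i j"
  using assms by (induction m i j rule: lpp.induct) auto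

lemma shadow_cong:
  assumes "\<And>a b. a \<le> i \<Longrightarrow> b \<le> j \<Longrightarrow> m a b = m' a b"
  shows "shadow m i j = shadow m' i j"
proof -
  have "lpp m a b = lpp m' a b" if "a \<le> i" "b \<le> j" for a b
    using that assms by (intro lpp_cong) auto
  then show ?thesis by (simp add: shadow_def)
qed

lemma shadow_power_cong:
  assumes "\<And>a b. a \<le> i \<Longrightarrow> b \<le> j \<Longrightarrow> m a b = m' a b" "a \<le> i" "b \<le> j"
  shows "(shadow ^^ k) m a b = (shadow ^^ k) m' a b"
  using assms(2-)
proof (induction k arbitrary: a b)
  case 0
  with assms(1) show ?case by auto
next
  case (Suc k)
  then show ?case by (auto intro: shadow_cong)
qed

definition rsk_shape :: "(nat \<Rightarrow> nat \<Rightarrow> nat) \<Rightarrow> nat \<Rightarrow> nat \<Rightarrow> nat \<Rightarrow> nat" where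
  "rsk_shape m i j k = lpp ((shadow ^^ k) m) i j"

lemma rsk_shape_cong:
  assumes "\<And>a b. a \<le> i \<Longrightarrow> b \<le> j \<Longrightarrow> m a b = m' a b"
  shows "rsk_shape m i j = rsk_shape m' i j"
  unfolding rsk_shape_def using assms by (intro ext lpp_cong shadow_power_cong) auto

text \<open>Here \<open>u\<close> and \<open>v\<close> are the shapes above and to the left of the new cell with entry \<open>x\<close>, and \<open>l\<close> is
  the shape diagonally before it.\<close>
definition grow :: "(nat \<Rightarrow> nat) \<Rightarrow> (nat \<Rightarrow> nat) \<Rightarrow> (nat \<Rightarrow> nat) \<Rightarrow> nat \<Rightarrow> nat \<Rightarrow> nat" where
  "grow l u v x k = (case k of 0 \<Rightarrow> x + max (u 0) (v 0)
     | Suc k' \<Rightarrow> (min (u k') (v k') - l k') + max (u k) (v k))"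

lemma rsk_shape_0 [simp]:
  "rsk_shape m 0 j = (\<lambda>_. 0)" "rsk_shape m i 0 = (\<lambda>_. 0)"
  by (auto simp: rsk_shape_def)

lemma rsk_shape_Suc_Suc:
  "rsk_shape m (Suc i) (Suc j) =
     grow (rsk_shape m i j) (rsk_shape m i (Suc j)) (rsk_shape m (Suc i) j) (m (Suc i) (Suc j))"
  by (auto simp: rsk_shape_def grow_def shadow_Suc_Suc fun_eq_iff split: nat.split)

lemma rsk_shape_mono: "i \<le> i' \<Longrightarrow> j \<le> j' \<Longrightarrow> rsk_shape m i j k \<le> rsk_shape m i' j' k"
  by (simp add: rsk_shape_def lpp_mono)

text \<open>In terms of diagrams, \<open>u\<close> arises from \<open>l\<close> by adding a
  horizontal strip. The two inequalities together force both sequences to be weakly decreasing, so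
  interlacing chains consist of partitions automatically.\<close>

definition interlace :: "(nat \<Rightarrow> nat) \<Rightarrow> (nat \<Rightarrow> nat) \<Rightarrow> bool" where
  "interlace l u \<longleftrightarrow> (\<forall>k. l k \<le> u k \<and> u (Suc k) \<le> l k)"

lemma interlace_le: "interlace l u \<Longrightarrow> l k \<le> u k"
  by (simp add: interlace_def)

lemma interlace_grow:
  assumes "interlace l u" "interlace l v"
  shows "interlace u (grow l u v x)" "interlace v (grow l u v x)"
proof -
  have le: "u k \<le> grow l u v x k" "v k \<le> grow l u v x k" for k
    by (auto simp: grow_def split: nat.split)
  have ge: "grow l u v x (Suc k) \<le> min (u k) (v k)" for k
  proof -
    have "max (u (Suc k)) (v (Suc k)) \<le> l k" "l k \<le> min (u k) (v k)"
      using assms by (auto simp: interlace_def)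
    then show ?thesis unfolding grow_def nat.case by linarith
  qed
  show "interlace u (grow l u v x)" "interlace v (grow l u v x)"
    unfolding interlace_def using le ge by (auto simp: order_trans[OF ge])
qed

text \<open>The growth rule is solved for its input: part \<open>Suc k\<close> of \<open>w\<close>
  determines \<open>l k\<close>, and part 0 determines \<open>x\<close>. The bounds
  \<open>max (u k) (v k) \<le> w k\<close> and \<open>w (Suc k) \<le> min (u k) (v k)\<close>
  prevent truncation and make \<open>l\<close> interlace.\<close>

lemma grow_inverse_exists:
  assumes "interlace u w" "interlace v w"
  shows "\<exists>l x. interlace l u \<and> interlace l v \<and> grow l u v x = w"
proof -
  let ?l = "\<lambda>k. max (u (Suc k)) (v (Suc k)) + min (u k) (v k) - w (Suc k)"
  let ?x = "w 0 - max (u 0) (v 0)"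
  have *: "u k \<le> w k" "v k \<le> w k" "w (Suc k) \<le> u k" "w (Suc k) \<le> v k" for k
    using assms by (auto simp: interlace_def)
  have "max (u k) (v k) \<le> w k" "w (Suc k) \<le> min (u k) (v k)" for k
    using * by auto
  note * = this
  have l: "?l k \<le> min (u k) (v k)" "max (u (Suc k)) (v (Suc k)) \<le> ?l k" for k
    using *(1)[of "Suc k"] *(2)[of k] by linarith+
  have "interlace ?l u" "interlace ?l v"
    unfolding interlace_def by (meson l min.bounded_iff max.bounded_iff)+
  moreover have "grow ?l u v ?x k = w k" for k
  proof (cases k)
    case 0 then show ?thesis using *(1)[of 0] by (simp add: grow_def)
  next
    case (Suc k') then show ?thesis using *(1)[of k] *(2)[of k']
      by (simp add: grow_def del: min.bounded_iff max.bounded_iff)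
  qed
  ultimately show ?thesis by blast
qed

lemma grow_inject:
  assumes "interlace l u" "interlace l v" "interlace l' u" "interlace l' v"
    and eq: "grow l u v x = grow l' u v x'"
  shows "l = l'" "x = x'"
proof -
  show "x = x'" using fun_cong[OF eq, of 0] by (simp add: grow_def)
  show "l = l'"
  proof
    fix k
    have "l k \<le> min (u k) (v k)" "l' k \<le> min (u k) (v k)"
      using assms by (auto simp: interlace_def)
    with fun_cong[OF eq, of "Suc k"] show "l k = l' k"
      unfolding grow_def nat.case by linarith
  qed
qed

definition size_upto :: "nat \<Rightarrow> (nat \<Rightarrow> nat) \<Rightarrow> nat" where
  "size_upto d l = (\<Sum>k<d. l k)"

text \<open>Minimum and maximum of \<open>u k\<close> and \<open>v k\<close> add up to
  \<open>u k + v k\<close>. Since part \<open>Suc k\<close> of \<open>grow\<close> involves part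
  \<open>k\<close> of \<open>l\<close>, one more part is summed on the left, and the term
  \<open>max (u d) (v d)\<close> remains until all parts from \<open>d\<close> on vanish.\<close>

lemma size_grow_partial:
  assumes "interlace l u" "interlace l v"
  shows "(\<Sum>k\<le>d. grow l u v x k) + (\<Sum>k<d. l k)
    = x + (\<Sum>k<d. u k) + (\<Sum>k<d. v k) + max (u d) (v d)"
proof (induction d)
  case 0
  show ?case by (simp add: grow_def)
next
  case (Suc d)
  have "l d \<le> min (u d) (v d)"
    using assms by (auto simp: interlace_def)
  then have "grow l u v x (Suc d) + l d + max (u d) (v d) = u d + v d + max (u (Suc d)) (v (Suc d))"
    by (auto simp: grow_def)
  with Suc show ?case by simp
qed

lemma size_grow:
  assumes "interlace l u" "interlace l v" "\<And>k. d \<le> k \<Longrightarrow> grow l u v x k = 0"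
  shows "size_upto d (grow l u v x) + size_upto d l = x + size_upto d u + size_upto d v"
proof -
  have "u d \<le> 0" "v d \<le> 0"
    using interlace_grow[OF assms(1,2), of x] assms(3)[of d] by (metis interlace_le order_refl)+
  with size_grow_partial[OF assms(1,2), where d = d and x = x] assms(3)[of d] show ?thesis
    by (simp add: size_upto_def lessThan_Suc_atMost[symmetric])
qed

lemma rsk_shape_interlace:
  "interlace (rsk_shape m i j) (rsk_shape m (Suc i) j) \<and> interlace (rsk_shape m i j) (rsk_shape m i (Suc j))"
proof (induction "i + j" arbitrary: i j rule: less_induct)
  case less
  have "interlace (rsk_shape m i (Suc b)) (rsk_shape m (Suc i) (Suc b))" if "j = Suc b" for b
    using less[of i b] that by (simp add: rsk_shape_Suc_Suc interlace_grow)
  moreover have "interlace (rsk_shape m (Suc a) j) (rsk_shape m (Suc a) (Suc j))" if "i = Suc a" for a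
    using less[of a j] that by (simp add: rsk_shape_Suc_Suc interlace_grow)
  moreover have "interlace (\<lambda>_. 0) (\<lambda>_. 0)" by (simp add: interlace_def)
  ultimately show ?case
    by (cases i; cases j) auto
qed

section \<open>Semistandard tableaux as interlacing chains, and the rows of a growth diagram\<close>

definition shape_chain :: "nat \<Rightarrow> (nat \<Rightarrow> nat \<Rightarrow> nat) \<Rightarrow> bool" where
  "shape_chain n p \<longleftrightarrow> p 0 = (\<lambda>_. 0) \<and> (\<forall>j<n. interlace (p j) (p (Suc j)))"

lemma shape_chain_rsk_shape: "shape_chain n (rsk_shape m i)"
  by (simp add: shape_chain_def rsk_shape_interlace)

lemma shape_chain_mono:
  assumes "shape_chain n p" "i \<le> j" "j \<le> n"
  shows "p i k \<le> p j k"
  using assms(2,3)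
proof (induction j rule: dec_induct)
  case (step j)
  then show ?case
    using assms(1) interlace_le[of "p j" "p (Suc j)" k] by (auto simp: shape_chain_def)
qed simp

definition row_step :: "nat \<Rightarrow> (nat \<Rightarrow> nat \<Rightarrow> nat) \<Rightarrow> (nat \<Rightarrow> nat) \<Rightarrow> (nat \<Rightarrow> nat \<Rightarrow> nat) \<Rightarrow> bool" where
  "row_step n p x q \<longleftrightarrow> (\<forall>j<n. q (Suc j) = grow (p j) (p (Suc j)) (q j) (x (Suc j)))"

lemma row_step_rsk_shape:
  "row_step n (rsk_shape m i) (m (Suc i)) (rsk_shape m (Suc i))"
  by (simp add: row_step_def rsk_shape_Suc_Suc)

lemma row_step_interlace:
  assumes "shape_chain n p" "q 0 = (\<lambda>_. 0)" "row_step n p x q" "j \<le> n"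
  shows "interlace (p j) (q j)"
  using assms(4)
proof (induction j)
  case 0
  with assms(1,2) show ?case by (simp add: shape_chain_def interlace_def)
next
  case (Suc j)
  then show ?case
    using assms(1,3) interlace_grow(1)[of "p j" "p (Suc j)" "q j"]
    by (simp add: shape_chain_def row_step_def)
qed

text \<open>The inverse growth rule is run from the last column back to the first. Starting from the
  shape \<open>l\<close> above the end of \<open>q\<close>, each cell yields one matrix entry and
  the next shape to the left.\<close>

lemma row_step_inverse_exists:
  assumes "shape_chain n q" "interlace l (q n)"
  shows "\<exists>p x. shape_chain n p \<and> p n = l \<and> row_step n p x q \<and> (\<forall>j. j \<notin> {1..n} \<longrightarrow> x j = 0)"
  using assms
proof (induction n arbitrary: l)
  case 0
  then have "l = (\<lambda>_. 0)" by (auto simp: shape_chain_def interlace_def)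
  then show ?case
    by (intro exI[of _ "\<lambda>_ _. 0"] exI[of _ "\<lambda>_. 0"]) (auto simp: shape_chain_def row_step_def)
next
  case (Suc n)
  then have "interlace (q n) (q (Suc n))" and q: "shape_chain n q"
    by (auto simp: shape_chain_def)
  with Suc.prems obtain l' y where l': "interlace l' l" "interlace l' (q n)" "grow l' l (q n) y = q (Suc n)"
    using grow_inverse_exists by blast
  from Suc.IH[OF q l'(2)] obtain p x where p: "shape_chain n p" "p n = l'" "row_step n p x q"
    "\<forall>j. j \<notin> {1..n} \<longrightarrow> x j = 0" by blast
  have "shape_chain (Suc n) (p(Suc n := l))"
    using p l' by (auto simp: shape_chain_def less_Suc_eq)
  moreover have "row_step (Suc n) (p(Suc n := l)) (x(Suc n := y)) q"
    using p l' by (auto simp: row_step_def less_Suc_eq)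
  moreover have "\<forall>j. j \<notin> {1..Suc n} \<longrightarrow> (x(Suc n := y)) j = 0" "(p(Suc n := l)) (Suc n) = l"
    using p(4) by auto
  ultimately show ?case by blast
qed

lemma row_step_inverse_unique:
  assumes "shape_chain n p" "shape_chain n p'" "p n = p' n" "q 0 = (\<lambda>_. 0)"
    and "row_step n p x q" "row_step n p' x' q"
  shows "(\<forall>j\<le>n. p j = p' j) \<and> (\<forall>j\<in>{1..n}. x j = x' j)"
  using assms
proof (induction n)
  case 0
  then show ?case by simp
next
  case (Suc n)
  have ch: "shape_chain n p" "shape_chain n p'" "row_step n p x q" "row_step n p' x' q"
    using Suc.prems by (auto simp: shape_chain_def row_step_def)
  have "interlace (p n) (p (Suc n))" "interlace (p' n) (p (Suc n))"
    using Suc.prems by (auto simp: shape_chain_def)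
  moreover have "interlace (p n) (q n)" "interlace (p' n) (q n)"
    using ch Suc.prems(4) row_step_interlace by blast+
  moreover have "grow (p n) (p (Suc n)) (q n) (x (Suc n)) = grow (p' n) (p (Suc n)) (q n) (x' (Suc n))"
    using Suc.prems by (metis row_step_def lessI)
  ultimately have "p n = p' n" "x (Suc n) = x' (Suc n)"
    using grow_inject by blast+
  with Suc.IH ch Suc.prems show ?case
    by (auto simp: le_Suc_eq atLeastAtMostSuc_conv)
qed

text \<open>Adding up \<open>size_grow\<close> along the row turns row sums into size increments, so
  regularity of the rows becomes the content of a tableau.\<close>

lemma row_step_sum:
  assumes "shape_chain n p" "q 0 = (\<lambda>_. 0)" "row_step n p x q" "shape_chain n q"
    and "\<And>k. d \<le> k \<Longrightarrow> q n k = 0" "j \<le> n"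
  shows "(\<Sum>b=1..j. x b) + size_upto d (p j) = size_upto d (q j)"
  using assms(6)
proof (induction j)
  case 0
  with assms(1,2) show ?case by (simp add: shape_chain_def size_upto_def)
next
  case (Suc j)
  have z: "q (Suc j) k = 0" if "d \<le> k" for k
    using shape_chain_mono[OF assms(4) Suc.prems, of k] assms(5)[OF that] by simp
  have eq: "q (Suc j) = grow (p j) (p (Suc j)) (q j) (x (Suc j))"
    using assms(3) Suc.prems by (simp add: row_step_def)
  have "interlace (p j) (p (Suc j))" using assms(1) Suc.prems by (simp add: shape_chain_def)
  moreover have "interlace (p j) (q j)" using row_step_interlace[OF assms(1-3)] Suc.prems by simp
  ultimately have "size_upto d (q (Suc j)) + size_upto d (p j)
      = x (Suc j) + size_upto d (p (Suc j)) + size_upto d (q j)"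
    using size_grow z eq by metis
  with Suc show ?case by simp
qed

section \<open>Matrices and Kostka numbers\<close>

definition lower_shapes :: "nat \<Rightarrow> nat \<Rightarrow> (nat \<Rightarrow> nat) \<Rightarrow> (nat \<Rightarrow> nat) set" where
  "lower_shapes d r l = {v. interlace v l \<and> size_upto d l = size_upto d v + r}"

text \<open>For shapes with at most \<open>d\<close> parts, this counts semistandard tableaux in
  which each of \<open>i\<close> values occurs \<open>r\<close> times, by removing the strip of the
  largest value.\<close>

fun kostka :: "nat \<Rightarrow> nat \<Rightarrow> nat \<Rightarrow> (nat \<Rightarrow> nat) \<Rightarrow> nat" where
  "kostka d r 0 l = (if l = (\<lambda>_. 0) then 1 else 0)"
| "kostka d r (Suc i) l = (\<Sum>v\<in>lower_shapes d r l. kostka d r i v)"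

lemma finite_lower_shapes:
  assumes "\<And>k. d \<le> k \<Longrightarrow> l k = 0"
  shows "finite (lower_shapes d r l)"
proof (rule finite_subset)
  show "finite {v. \<forall>k. (k \<in> {..<d} \<longrightarrow> v k \<in> {..Max (l ` {..<d})}) \<and> (k \<notin> {..<d} \<longrightarrow> v k = 0)}"
    by (rule finite_set_of_finite_funs) auto
  show "lower_shapes d r l \<subseteq> {v. \<forall>k. (k \<in> {..<d} \<longrightarrow> v k \<in> {..Max (l ` {..<d})}) \<and> (k \<notin> {..<d} \<longrightarrow> v k = 0)}"
  proof (intro subsetI CollectI allI conjI impI)
    fix v k assume v: "v \<in> lower_shapes d r l"
    then have le: "v k \<le> l k" by (auto simp: lower_shapes_def interlace_le)
    show "v k \<in> {..Max (l ` {..<d})}" if "k \<in> {..<d}"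
      using le that order_trans[OF le Max_ge] by simp
    show "v k = 0" if "k \<notin> {..<d}"
      using le that assms[of k] by simp
  qed
qed

lemma lower_shapes_zero_beyond:
  assumes "\<And>k. d \<le> k \<Longrightarrow> l k = 0" "v \<in> lower_shapes d r l" "d \<le> k"
  shows "v k = 0"
  using assms(1)[OF assms(3)] assms(2) interlace_le[of v l k] by (simp add: lower_shapes_def)

definition matrices_with_shapes ::
  "nat \<Rightarrow> nat \<Rightarrow> nat \<Rightarrow> (nat \<Rightarrow> nat \<Rightarrow> nat) \<Rightarrow> (nat \<Rightarrow> nat \<Rightarrow> nat) set" where
  "matrices_with_shapes r i n p = {m. (\<forall>a b. m a b \<noteq> 0 \<longrightarrow> a \<in> {1..i} \<and> b \<in> {1..n}) \<and>
     (\<forall>a\<in>{1..i}. (\<Sum>b=1..n. m a b) = r) \<and> (\<forall>j\<le>n. rsk_shape m i j = p j)}"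

lemma rsk_shape_upd_row: "a \<le> i \<Longrightarrow> rsk_shape (m(Suc i := x)) a j = rsk_shape m a j"
  by (rule rsk_shape_cong) auto

text \<open>The recording half of RSK. With the last row \<open>p\<close> of the growth diagram
  fixed, the shape \<open>v\<close> at the end of the row above determines that whole row and the
  last matrix row. Hence the matrices correspond to the chains of shapes in the last column, and row
  sum \<open>r\<close> means a size drop of \<open>r\<close>.\<close>

lemma card_matrices_with_shapes:
  assumes "shape_chain n p" "\<And>k. d \<le> k \<Longrightarrow> p n k = 0"
  shows "finite (matrices_with_shapes r i n p) \<and> card (matrices_with_shapes r i n p) = kostka d r i (p n)"
  using assms
proof (induction i arbitrary: p)
  case 0
  have "matrices_with_shapes r 0 n p = (if p n = (\<lambda>_. 0) then {\<lambda>_ _. 0} else {})"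
  proof (cases "p n = (\<lambda>_. 0)")
    case True
    then have "p j = (\<lambda>_. 0)" if "j \<le> n" for j
      using shape_chain_mono[OF 0(1) that, of] by (auto simp: fun_eq_iff)
    with True show ?thesis
      by (auto simp: matrices_with_shapes_def fun_eq_iff)
  next
    case False
    then show ?thesis by (auto simp: matrices_with_shapes_def)
  qed
  then show ?case by simp
next
  case (Suc i)
  let ?N = "lower_shapes d r (p n)"
  have p0: "p 0 = (\<lambda>_. 0)" using Suc.prems(1) by (simp add: shape_chain_def)
  have "\<forall>v\<in>?N. \<exists>q x. shape_chain n q \<and> q n = v \<and> row_step n q x p \<and> (\<forall>j. j \<notin> {1..n} \<longrightarrow> x j = 0)"
    using row_step_inverse_exists[OF Suc.prems(1)] by (auto simp: lower_shapes_def)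
  then obtain q x where qx: "\<And>v. v \<in> ?N \<Longrightarrow> shape_chain n (q v) \<and> q v n = v \<and>
      row_step n (q v) (x v) p \<and> (\<forall>j. j \<notin> {1..n} \<longrightarrow> x v j = 0)"
    by metis
  let ?S = "\<lambda>v. (\<lambda>m. m(Suc i := x v)) ` matrices_with_shapes r i n (q v)"
  have IH: "finite (matrices_with_shapes r i n (q v))"
    "card (matrices_with_shapes r i n (q v)) = kostka d r i v" if "v \<in> ?N" for v
    using Suc.IH[of "q v"] qx[OF that] lower_shapes_zero_beyond[OF Suc.prems(2) that] by auto
  have eq: "matrices_with_shapes r (Suc i) n p = (\<Union>v\<in>?N. ?S v)"
  proof (intro equalityI subsetI)
    fix m assume m: "m \<in> matrices_with_shapes r (Suc i) n p"
    define v where "v = rsk_shape m i n"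
    have sh: "\<And>j. j \<le> n \<Longrightarrow> rsk_shape m (Suc i) j = p j" using m by (simp add: matrices_with_shapes_def)
    have rs: "row_step n (rsk_shape m i) (m (Suc i)) p"
      using row_step_rsk_shape[of n m i] sh by (simp add: row_step_def)
    have "(\<Sum>b=1..n. m (Suc i) b) + size_upto d v = size_upto d (p n)"
      unfolding v_def
      by (rule row_step_sum[OF shape_chain_rsk_shape p0 rs Suc.prems order_refl])
    moreover have "(\<Sum>b=1..n. m (Suc i) b) = r" using m by (simp add: matrices_with_shapes_def)
    moreover have "interlace v (p n)"
      unfolding v_def using row_step_interlace[OF shape_chain_rsk_shape p0 rs] by simp
    ultimately have v: "v \<in> ?N" by (simp add: lower_shapes_def)
    have u: "(\<forall>j\<le>n. q v j = rsk_shape m i j) \<and> (\<forall>j\<in>{1..n}. x v j = m (Suc i) j)"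
      by (rule row_step_inverse_unique[OF _ shape_chain_rsk_shape _ p0 _ rs])
        (use qx[OF v] v_def in auto)
    have "x v = m (Suc i)"
    proof
      fix j
      show "x v j = m (Suc i) j"
        using u qx[OF v] m by (cases "j \<in> {1..n}") (auto simp: matrices_with_shapes_def)
    qed
    \<comment> \<open>The last row is cleared to meet the support condition for the first
      \<open>i\<close> rows and then put back.\<close>
    then have "m = (m(Suc i := \<lambda>_. 0))(Suc i := x v)" by auto
    moreover have "m(Suc i := \<lambda>_. 0) \<in> matrices_with_shapes r i n (q v)"
      using m u by (auto simp: matrices_with_shapes_def rsk_shape_upd_row le_Suc_eq)
    ultimately show "m \<in> (\<Union>v\<in>?N. ?S v)" using v by blast
  next
    fix m' assume "m' \<in> (\<Union>v\<in>?N. ?S v)"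
    then obtain v m where v: "v \<in> ?N" and m: "m \<in> matrices_with_shapes r i n (q v)"
      and m': "m' = m(Suc i := x v)" by blast
    have sh: "rsk_shape m' (Suc i) j = p j" if "j \<le> n" for j
      using that
    proof (induction j)
      case 0
      then show ?case by (simp add: p0)
    next
      case (Suc j)
      have "rsk_shape m' i j = q v j" "rsk_shape m' i (Suc j) = q v (Suc j)"
        using m m' Suc.prems by (auto simp: rsk_shape_upd_row matrices_with_shapes_def)
      moreover have "m' (Suc i) = x v" using m' by simp
      ultimately show ?case
        using Suc qx[OF v] by (simp add: rsk_shape_Suc_Suc row_step_def)
    qed
    have "(\<Sum>b=1..n. x v b) + size_upto d (q v n) = size_upto d (p n)"
      using qx[OF v] Suc.prems p0 by (intro row_step_sum[of n "q v" p "x v"]) auto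
    then have "(\<Sum>b=1..n. x v b) = r"
      using v qx[OF v] by (simp add: lower_shapes_def)
    then show "m' \<in> matrices_with_shapes r (Suc i) n p"
      using m m' sh qx[OF v] by (auto simp: matrices_with_shapes_def le_Suc_eq)
  qed
  have fin: "finite ?N" using finite_lower_shapes Suc.prems(2) by blast
  have inj: "inj_on (\<lambda>m. m(Suc i := y)) (matrices_with_shapes r i n q')" for y q'
  proof (rule inj_onI)
    fix m m' assume "m \<in> matrices_with_shapes r i n q'" "m' \<in> matrices_with_shapes r i n q'"
      and e: "m(Suc i := y) = m'(Suc i := y)"
    then have "m (Suc i) = (\<lambda>_. 0)" "m' (Suc i) = (\<lambda>_. 0)"
      by (force simp: matrices_with_shapes_def)+
    then show "m = m'" using e by (metis fun_upd_triv fun_upd_upd)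
  qed
  have sh: "rsk_shape m i n = v" if "v \<in> ?N" "m \<in> ?S v" for v m
    using that qx[OF that(1)] by (auto simp: matrices_with_shapes_def rsk_shape_upd_row)
  have disj: "?S v \<inter> ?S w = {}" if "v \<in> ?N" "w \<in> ?N" "v \<noteq> w" for v w
  proof (rule equals0I)
    fix m assume "m \<in> ?S v \<inter> ?S w"
    then show False using sh[OF that(1), of m] sh[OF that(2), of m] that(3) by (elim IntE) simp
  qed
  have "card (\<Union>v\<in>?N. ?S v) = (\<Sum>v\<in>?N. card (?S v))"
    by (intro card_UN_disjoint ballI impI finite_imageI fin IH disj)
  also have "\<dots> = kostka d r (Suc i) (p n)"
    using IH by (auto intro!: sum.cong simp: card_image[OF inj])
  finally show ?case using eq fin IH by simp
qed

text \<open>Values beyond \<open>n\<close> are pinned to zero so that counting functions counts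
  chains.\<close>

definition regular_shape_chains :: "nat \<Rightarrow> nat \<Rightarrow> nat \<Rightarrow> (nat \<Rightarrow> nat) \<Rightarrow> (nat \<Rightarrow> nat \<Rightarrow> nat) set" where
  "regular_shape_chains d r n l = {p. shape_chain n p \<and>
     (\<forall>j<n. size_upto d (p (Suc j)) = size_upto d (p j) + r) \<and>
     p n = l \<and> (\<forall>j>n. p j = (\<lambda>_. 0))}"

lemma card_regular_shape_chains:
  assumes "\<And>k. d \<le> k \<Longrightarrow> l k = 0"
  shows "finite (regular_shape_chains d r n l) \<and> card (regular_shape_chains d r n l) = kostka d r n l"
  using assms
proof (induction n arbitrary: l)
  case 0
  have "regular_shape_chains d r 0 l = (if l = (\<lambda>_. 0) then {\<lambda>_ _. 0} else {})"
    by (auto simp: regular_shape_chains_def shape_chain_def fun_eq_iff) (metis not_gr_zero)+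
  then show ?case by simp
next
  case (Suc n)
  let ?N = "lower_shapes d r l"
  let ?S = "\<lambda>v. (\<lambda>p. p(Suc n := l)) ` regular_shape_chains d r n v"
  have IH: "finite (regular_shape_chains d r n v)"
    "card (regular_shape_chains d r n v) = kostka d r n v" if "v \<in> ?N" for v
    using Suc.IH[of v] lower_shapes_zero_beyond[OF Suc.prems that] by auto
  have eq: "regular_shape_chains d r (Suc n) l = (\<Union>v\<in>?N. ?S v)"
  proof (intro equalityI subsetI)
    fix p assume p: "p \<in> regular_shape_chains d r (Suc n) l"
    then have "p n \<in> ?N"
      by (auto simp: regular_shape_chains_def lower_shapes_def shape_chain_def)
    moreover have "p(Suc n := \<lambda>_. 0) \<in> regular_shape_chains d r n (p n)"
      using p by (auto simp: regular_shape_chains_def shape_chain_def)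
    moreover have "p = (p(Suc n := \<lambda>_. 0))(Suc n := l)"
      using p by (auto simp: regular_shape_chains_def)
    ultimately show "p \<in> (\<Union>v\<in>?N. ?S v)" by blast
  qed (auto simp: regular_shape_chains_def lower_shapes_def shape_chain_def less_Suc_eq)
  have fin: "finite ?N" using finite_lower_shapes Suc.prems by blast
  have inj: "inj_on (\<lambda>p. p(Suc n := l)) (regular_shape_chains d r n v)" for v
  proof (rule inj_onI)
    fix p p' assume "p \<in> regular_shape_chains d r n v" "p' \<in> regular_shape_chains d r n v"
      and e: "p(Suc n := l) = p'(Suc n := l)"
    then have "p (Suc n) = (\<lambda>_. 0)" "p' (Suc n) = (\<lambda>_. 0)"
      by (auto simp: regular_shape_chains_def)
    then show "p = p'" using e by (metis fun_upd_triv fun_upd_upd)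
  qed
  have "p n = v" if "p \<in> ?S v" for p v
    using that by (auto simp: regular_shape_chains_def)
  then have disj: "?S v \<inter> ?S w = {}" if "v \<noteq> w" for v w
    using that by blast
  have "card (\<Union>v\<in>?N. ?S v) = (\<Sum>v\<in>?N. card (?S v))"
    by (intro card_UN_disjoint ballI impI finite_imageI fin IH disj)
  also have "\<dots> = kostka d r (Suc n) l"
    using IH by (auto intro!: sum.cong simp: card_image[OF inj])
  finally show ?case using eq fin IH by simp
qed

section \<open>Planar matchings and the first missing part\<close>

lemma finite_planar_matchings:
  assumes "\<And>i j. M i j \<noteq> 0 \<Longrightarrow> i \<in> {1..n} \<and> j \<in> {1..n}"
  shows "finite {S. planar_matching M S}"
proof (rule finite_subset)
  show "{S. planar_matching M S} \<subseteq> Pow ({1..n} \<times> {1..n})"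
    using assms by (fastforce simp: planar_matching_def)
qed simp

lemma L_le_iff:
  assumes "\<And>i j. M i j \<noteq> 0 \<Longrightarrow> i \<in> {1..n} \<and> j \<in> {1..n}"
  shows "L M \<le> d \<longleftrightarrow> (\<forall>S. planar_matching M S \<longrightarrow> card S \<le> d)"
proof -
  have "planar_matching M {}" by (simp add: planar_matching_def)
  then show ?thesis
    unfolding L_def using finite_planar_matchings[OF assms] by (subst Max_le_iff) auto
qed

lemma planar_matching_of_chain:
  assumes supp: "\<And>i j. M i j \<noteq> 0 \<Longrightarrow> i \<in> {1..n} \<and> j \<in> {1..n}"
    and "descending_chain (\<lambda>i j. M i (Suc n - j)) k"
  shows "\<exists>S. planar_matching M S \<and> card S = k"
proof -
  obtain i j where ij: "\<And>t. t < k \<Longrightarrow> 0 < M (i t) (Suc n - j t)"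
    "\<And>t. Suc t < k \<Longrightarrow> i t < i (Suc t) \<and> j (Suc t) < j t"
    using assms(2) unfolding descending_chain_def by auto
  let ?e = "\<lambda>t. (i t, Suc n - j t)"
  \<comment> \<open>The support condition puts \<open>Suc n - j t\<close> in \<open>{1..n}\<close>;
    hence nothing is truncated and the column order is truly reversed.\<close>
  have step: "i t < i (Suc t) \<and> Suc n - j t < Suc n - j (Suc t)" if "Suc t < k" for t
    using ij(1)[of t] ij(2)[of t] supp[of "i t" "Suc n - j t"] that by auto
  have mono: "i s < i t \<and> Suc n - j s < Suc n - j t" if "s < t" "t < k" for s t
    using that
  proof (induction t)
    case (Suc t)
    then show ?case using step[of t] by (cases "s = t") auto
  qed simp
  have "inj_on ?e {..<k}"
    by (rule linorder_inj_onI) (use mono in fastforce)+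
  then have "card (?e ` {..<k}) = k" by (simp add: card_image)
  moreover have "planar_matching M (?e ` {..<k})"
    unfolding planar_matching_def
  proof (intro conjI ballI impI)
    fix e e' assume "e \<in> ?e ` {..<k}" "e' \<in> ?e ` {..<k}" "e \<noteq> e'"
    then obtain s t where "s < k" "t < k" "s \<noteq> t" "e = ?e s" "e' = ?e t" by auto
    with mono[of s t] mono[of t s] show "noncrossing e e'"
      by (cases "s < t") (auto simp: noncrossing_def)
  qed (use ij in auto)
  ultimately show ?thesis by blast
qed

lemma chain_of_planar_matching:
  assumes supp: "\<And>i j. M i j \<noteq> 0 \<Longrightarrow> i \<in> {1..n} \<and> j \<in> {1..n}"
    and S: "planar_matching M S" "k \<le> card S"
  shows "descending_chain (\<lambda>i j. M i (Suc n - j)) k"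
proof (cases "k = 0")
  case True
  then show ?thesis by (simp add: descending_chain_def)
next
  case False
  \<comment> \<open>Infinite sets have \<open>card\<close> 0, so a positive \<open>k\<close>
    excludes them.\<close>
  with S have fin: "finite S" by (metis card.infinite le_zero_eq)
  have nc: "noncrossing e e'" if "e \<in> S" "e' \<in> S" "e \<noteq> e'" for e e'
    using S(1) that by (auto simp: planar_matching_def)
  \<comment> \<open>Noncrossing edges never share a row. Listing the edges by row is therefore
    faithful, and their columns increase along the list.\<close>
  then have inj: "inj_on fst S"
    by (intro inj_onI) (force simp: noncrossing_def)
  define xs where "xs = sorted_list_of_set (fst ` S)"
  have len: "length xs = card S" and xs: "set xs = fst ` S" "sorted_wrt (<) xs"
    using fin by (simp_all add: xs_def card_image[OF inj])
  have "\<forall>t<k. \<exists>e\<in>S. fst e = xs ! t"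
    using len xs(1) S(2) by (metis (no_types, lifting) imageE less_le_trans nth_mem)
  then obtain e where e: "\<And>t. t < k \<Longrightarrow> e t \<in> S \<and> fst (e t) = xs ! t" by metis
  have pos: "0 < M (fst (e t)) (snd (e t))" if "t < k" for t
    using e[OF that] S(1) by (auto simp: planar_matching_def)
  have sn: "snd (e t) \<le> n" if "t < k" for t
    using pos[OF that] supp by force
  show ?thesis
    unfolding descending_chain_def
  proof (rule exI[of _ "\<lambda>t. fst (e t)"], rule exI[of _ "\<lambda>t. Suc n - snd (e t)"], intro conjI allI impI)
    fix t assume "t < k"
    with pos sn show "0 < M (fst (e t)) (Suc n - (Suc n - snd (e t)))"
      by (simp add: Suc_diff_le)
  next
    fix t assume t: "Suc t < k"
    then show lt: "fst (e t) < fst (e (Suc t))"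
      using e[of t] e[of "Suc t"] sorted_wrt_nth_less[OF xs(2), of t "Suc t"] len S(2) by auto
    then have "noncrossing (e t) (e (Suc t))"
      using e[of t] e[of "Suc t"] t by (intro nc) auto
    with lt have "snd (e t) < snd (e (Suc t))"
      by (auto simp: noncrossing_def)
    then show "Suc n - snd (e (Suc t)) < Suc n - snd (e t)"
      using sn[OF t] by auto
  qed
qed

lemma L_le_iff_no_chain:
  assumes supp: "\<And>i j. M i j \<noteq> 0 \<Longrightarrow> i \<in> {1..n} \<and> j \<in> {1..n}"
  shows "L M \<le> d \<longleftrightarrow> \<not> descending_chain (\<lambda>i j. M i (Suc n - j)) (Suc d)"
proof -
  have le: "L M \<le> d \<longleftrightarrow> (\<forall>S. planar_matching M S \<longrightarrow> card S \<le> d)"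
    by (rule L_le_iff) (rule supp)
  show ?thesis
  proof
    assume *: "L M \<le> d"
    show "\<not> descending_chain (\<lambda>i j. M i (Suc n - j)) (Suc d)"
    proof
      assume "descending_chain (\<lambda>i j. M i (Suc n - j)) (Suc d)"
      with supp have "\<exists>S. planar_matching M S \<and> card S = Suc d"
        by (rule planar_matching_of_chain)
      with * le show False by fastforce
    qed
  next
    assume *: "\<not> descending_chain (\<lambda>i j. M i (Suc n - j)) (Suc d)"
    show "L M \<le> d"
      unfolding le
    proof (intro allI impI, rule ccontr)
      fix S assume "planar_matching M S" "\<not> card S \<le> d"
      then have "descending_chain (\<lambda>i j. M i (Suc n - j)) (Suc d)"
        by (intro chain_of_planar_matching[of M n S] supp) auto
      with * show False ..
    qed
  qed
qed

section \<open>Supports of shadows and vanishing parts\<close>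

lemma lpp_Suc_left_outside:
  assumes "\<And>a b. m a b \<noteq> 0 \<Longrightarrow> a \<le> n" "n \<le> i"
  shows "lpp m (Suc i) j = lpp m i j"
proof (induction j)
  case (Suc j)
  have "m (Suc i) (Suc j) = 0" using assms by force
  with Suc lpp_le_Suc_right[of m i j] show ?case by simp
qed simp

lemma lpp_Suc_right_outside:
  assumes "\<And>a b. m a b \<noteq> 0 \<Longrightarrow> b \<le> n" "n \<le> j"
  shows "lpp m i (Suc j) = lpp m i j"
proof (induction i)
  case (Suc i)
  have "m (Suc i) (Suc j) = 0" using assms by force
  with Suc lpp_le_Suc_left[of m i j] show ?case by simp
qed simp

lemma shadow_support:
  assumes "\<And>a b. m a b \<noteq> 0 \<Longrightarrow> a \<in> {1..n} \<and> b \<in> {1..n}" "shadow m i j \<noteq> 0"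
  shows "i \<in> {1..n} \<and> j \<in> {1..n}"
proof -
  obtain a b where ab: "i = Suc a" "j = Suc b"
    using assms(2) by (cases i; cases j) auto
  with assms(2) have "lpp m (Suc a) b \<noteq> lpp m a b" "lpp m a (Suc b) \<noteq> lpp m a b"
    by (auto simp: shadow_Suc_Suc)
  then have "\<not> n \<le> a" "\<not> n \<le> b"
    using lpp_Suc_left_outside[of m n a b] lpp_Suc_right_outside[of m n b a] assms(1) by force+
  with ab show ?thesis by auto
qed

lemma shadow_power_support:
  assumes "\<And>a b. m a b \<noteq> 0 \<Longrightarrow> a \<in> {1..n} \<and> b \<in> {1..n}" "(shadow ^^ k) m i j \<noteq> 0"
  shows "i \<in> {1..n} \<and> j \<in> {1..n}"
  using assms(2)
proof (induction k arbitrary: i j)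
  case 0
  then show ?case using assms(1) by simp
next
  case (Suc k)
  then have "shadow ((shadow ^^ k) m) i j \<noteq> 0" by simp
  from shadow_support[OF Suc.IH this] show ?case .
qed

lemma lpp_zero: "(\<And>a b. m a b = 0) \<Longrightarrow> lpp m i j = 0"
  using lpp_empty_rectangle[of 0 i 0 j m i j] by simp

lemma entry_le_lpp: "0 < i \<Longrightarrow> 0 < j \<Longrightarrow> m i j \<le> lpp m i j"
  by (cases i; cases j) auto

lemma rsk_shape_antimono: "rsk_shape m i j (Suc k) \<le> rsk_shape m i j k"
proof (cases i)
  case (Suc a)
  then show ?thesis
    using rsk_shape_interlace[of m a j] unfolding interlace_def by (meson order_trans)
qed simp

text \<open>Having no chain of length \<open>Suc d\<close> means that the \<open>d\<close>-th shadow
  is zero. Its total last passage time is part \<open>d\<close> of the shape, counted from 0, and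
  later parts are no larger.\<close>

lemma no_chain_iff_rsk_shape:
  assumes supp: "\<And>a b. m a b \<noteq> 0 \<Longrightarrow> a \<in> {1..n} \<and> b \<in> {1..n}"
  shows "\<not> descending_chain m (Suc d) \<longleftrightarrow> (\<forall>k\<ge>d. rsk_shape m n n k = 0)"
proof -
  have "\<not> descending_chain m (Suc d) \<longleftrightarrow> (\<forall>i j. (shadow ^^ d) m i j = 0)"
    using supp by (subst descending_chain_iff_shadow_power) force+
  also have "\<dots> \<longleftrightarrow> rsk_shape m n n d = 0"
  proof
    assume 0: "rsk_shape m n n d = 0"
    show "\<forall>i j. (shadow ^^ d) m i j = 0"
    proof (intro allI, rule ccontr)
      fix i j assume nz: "(shadow ^^ d) m i j \<noteq> 0"
      from shadow_power_support[OF supp this] have ij: "i \<in> {1..n}" "j \<in> {1..n}" by auto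
      then have "(shadow ^^ d) m i j \<le> lpp ((shadow ^^ d) m) i j" by (intro entry_le_lpp) auto
      also have "\<dots> \<le> rsk_shape m n n d" unfolding rsk_shape_def using ij by (intro lpp_mono) auto
      finally show False using 0 nz by simp
    qed
  qed (simp add: rsk_shape_def lpp_zero)
  also have "\<dots> \<longleftrightarrow> (\<forall>k\<ge>d. rsk_shape m n n k = 0)"
  proof (intro iffI allI impI)
    fix k assume "rsk_shape m n n d = 0" "d \<le> k"
    then show "rsk_shape m n n k = 0"
      using lift_Suc_antimono_le[of "rsk_shape m n n" d k, OF rsk_shape_antimono] by simp
  qed simp
  finally show ?thesis .
qed

text \<open>The column counterpart of \<open>row_step_sum\<close>: column sums are the size
  increments along the last row of the growth diagram.\<close>

lemma rsk_shape_column_sum: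
  assumes "\<And>k. d \<le> k \<Longrightarrow> rsk_shape m i (Suc j) k = 0"
  shows "(\<Sum>a=1..i. m a (Suc j)) + size_upto d (rsk_shape m i j) = size_upto d (rsk_shape m i (Suc j))"
  using assms
proof (induction i)
  case (Suc i)
  have "rsk_shape m i (Suc j) k = 0" if "d \<le> k" for k
    using rsk_shape_mono[of i "Suc i" "Suc j" "Suc j" m k] Suc.prems[OF that] by simp
  note IH = Suc.IH[OF this]
  show ?case
    using size_grow[of "rsk_shape m i j" "rsk_shape m i (Suc j)" "rsk_shape m (Suc i) j" d "m (Suc i) (Suc j)"]
      rsk_shape_interlace[of m i j] Suc.prems IH
    by (simp add: rsk_shape_Suc_Suc)
qed (simp add: size_upto_def)

section \<open>Counting matrices by pairs of tableaux\<close>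

definition shapes :: "nat \<Rightarrow> nat \<Rightarrow> (nat \<Rightarrow> nat) set" where
  "shapes d N = {l. (\<forall>k. l (Suc k) \<le> l k) \<and> (\<forall>k\<ge>d. l k = 0) \<and> l 0 \<le> N}"

lemma finite_shapes: "finite (shapes d N)"
proof (rule finite_subset)
  show "finite {l. \<forall>k. (k \<in> {..<d} \<longrightarrow> l k \<in> {..N}) \<and> (k \<notin> {..<d} \<longrightarrow> l k = 0)}" (is "finite ?B")
    by (rule finite_set_of_finite_funs) auto
  have "l k \<le> N" if "l \<in> shapes d N" for l k
    using that lift_Suc_antimono_le[of l 0 k] by (simp add: shapes_def)
  then show "shapes d N \<subseteq> ?B"
    by (auto simp: shapes_def)
qed

definition bounded_regular :: "nat \<Rightarrow> nat \<Rightarrow> nat \<Rightarrow> (nat \<Rightarrow> nat \<Rightarrow> nat) set" where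
  "bounded_regular d r n = {m. regular_multigraph r n m \<and> (\<forall>k\<ge>d. rsk_shape m n n k = 0)}"

text \<open>The chain \<open>p\<close> along the last row of the growth diagram encodes the column
  sums, \<open>matrices_with_shapes\<close> the row sums, and the common end \<open>l\<close> the
  bound on the number of parts.\<close>

lemma bounded_regular_eq:
  assumes "1 \<le> d" "r * n \<le> N"
  shows "bounded_regular d r n =
    (\<Union>l\<in>shapes d N. \<Union>p\<in>regular_shape_chains d r n l. matrices_with_shapes r n n p)"
proof (intro equalityI subsetI)
  fix m assume m: "m \<in> bounded_regular d r n"
  let ?l = "rsk_shape m n n" and ?p = "\<lambda>j. if j \<le> n then rsk_shape m n j else (\<lambda>_. 0)"
  have z: "rsk_shape m n j k = 0" if "j \<le> n" "d \<le> k" for j k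
    using rsk_shape_mono[of n n j n m k] that m by (simp add: bounded_regular_def)
  have st: "size_upto d (rsk_shape m n (Suc j)) = size_upto d (rsk_shape m n j) + r" if "j < n" for j
    using rsk_shape_column_sum[of d m n j] z[of "Suc j"] that m
    by (simp add: bounded_regular_def regular_multigraph_def)
  have sz: "j \<le> n \<Longrightarrow> size_upto d (rsk_shape m n j) = r * j" for j
    by (induction j) (simp_all add: st, simp add: size_upto_def)
  \<comment> \<open>The first part is at most the total size \<open>r * n\<close>;
    \<open>1 \<le> d\<close> puts index 0 into the range of summation.\<close>
  have "?l 0 \<le> size_upto d ?l"
    unfolding size_upto_def using assms(1) by (intro member_le_sum) auto
  with sz[of n] assms m have l: "?l \<in> shapes d N"
    by (simp add: shapes_def rsk_shape_antimono bounded_regular_def)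
  have p: "?p \<in> regular_shape_chains d r n ?l"
    using st shape_chain_rsk_shape[of n m n] by (simp add: regular_shape_chains_def shape_chain_def)
  have "m \<in> matrices_with_shapes r n n ?p"
    using m by (auto simp: bounded_regular_def regular_multigraph_def matrices_with_shapes_def)
  with l p show "m \<in> (\<Union>l\<in>shapes d N. \<Union>p\<in>regular_shape_chains d r n l. matrices_with_shapes r n n p)"
    by blast
next
  fix m assume "m \<in> (\<Union>l\<in>shapes d N. \<Union>p\<in>regular_shape_chains d r n l. matrices_with_shapes r n n p)"
  then obtain l p where l: "l \<in> shapes d N" and p: "p \<in> regular_shape_chains d r n l"
    and m: "m \<in> matrices_with_shapes r n n p" by blast
  have sh: "rsk_shape m n j = p j" if "j \<le> n" for j
    using m that by (simp add: matrices_with_shapes_def)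
  have z: "p j k = 0" if "j \<le> n" "d \<le> k" for j k
    using shape_chain_mono[of n p j n k] p l that by (simp add: regular_shape_chains_def shapes_def)
  have "(\<Sum>a=1..n. m a j) = r" if j: "j \<in> {1..n}" for j
  proof -
    obtain b where b: "j = Suc b" "b < n" using j by (cases j) auto
    then have "size_upto d (p (Suc b)) = size_upto d (p b) + r"
      using p by (simp add: regular_shape_chains_def)
    then show ?thesis using rsk_shape_column_sum[of d m n b] b z sh by simp
  qed
  then show "m \<in> bounded_regular d r n"
    using m z[of n] sh[of n]
    by (simp add: bounded_regular_def regular_multigraph_def matrices_with_shapes_def)
qed

lemma card_bounded_regular:
  assumes "1 \<le> d" "r * n \<le> N"
  shows "card (bounded_regular d r n) = (\<Sum>l\<in>shapes d N. kostka d r n l * kostka d r n l)"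
proof -
  let ?C = "regular_shape_chains d r n" and ?S = "matrices_with_shapes r n n"
  have C: "finite (?C l)" "card (?C l) = kostka d r n l" if "l \<in> shapes d N" for l
    using card_regular_shape_chains[of d l] that by (simp_all add: shapes_def)
  have S: "finite (?S p)" "card (?S p) = kostka d r n l" if "l \<in> shapes d N" "p \<in> ?C l" for l p
    using card_matrices_with_shapes[of n p d r n] that
    by (auto simp: shapes_def regular_shape_chains_def)
  have pl: "p n = l" if "p \<in> ?C l" for p l using that by (simp add: regular_shape_chains_def)
  have eq: "p = p'" if "p \<in> ?C l" "p' \<in> ?C l'" "m \<in> ?S p" "m \<in> ?S p'" for p p' l l' m
  proof
    fix j show "p j = p' j"
      using that by (cases "j \<le> n") (auto simp: regular_shape_chains_def matrices_with_shapes_def)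
  qed
  have "card (\<Union>p\<in>?C l. ?S p) = (\<Sum>p\<in>?C l. card (?S p))" if "l \<in> shapes d N" for l
    using that eq by (intro card_UN_disjoint ballI impI C S) blast+
  then have inner: "card (\<Union>p\<in>?C l. ?S p) = kostka d r n l * kostka d r n l" if "l \<in> shapes d N" for l
    using that C S by simp
  have "card (\<Union>l\<in>shapes d N. \<Union>p\<in>?C l. ?S p) = (\<Sum>l\<in>shapes d N. card (\<Union>p\<in>?C l. ?S p))"
  proof (rule card_UN_disjoint)
    show "\<forall>l\<in>shapes d N. \<forall>l'\<in>shapes d N. l \<noteq> l' \<longrightarrow> (\<Union>p\<in>?C l. ?S p) \<inter> (\<Union>p\<in>?C l'. ?S p) = {}"
    proof (intro ballI impI equals0I)
      fix l l' m
      assume "l \<noteq> l'" "m \<in> (\<Union>p\<in>?C l. ?S p) \<inter> (\<Union>p\<in>?C l'. ?S p)"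
      then obtain p p' where "p \<in> ?C l" "p' \<in> ?C l'" "m \<in> ?S p" "m \<in> ?S p'" by blast
      with eq pl \<open>l \<noteq> l'\<close> show False by metis
    qed
  next
    show "\<forall>l\<in>shapes d N. finite (\<Union>p\<in>?C l. ?S p)"
    proof
      fix l assume l: "l \<in> shapes d N"
      show "finite (\<Union>p\<in>?C l. ?S p)"
        by (rule finite_UN_I[OF C(1)[OF l]]) (rule S(1)[OF l])
    qed
  qed (rule finite_shapes)
  then show ?thesis using inner by (simp add: bounded_regular_eq[OF assms])
qed

lemma regular_multigraph_reflect:
  assumes "regular_multigraph r n M"
  shows "regular_multigraph r n (\<lambda>i j. M i (Suc n - j))"
proof -
  have "(\<Sum>j=1..n. M i (Suc n - j)) = (\<Sum>j=1..n. M i j)" for i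
    by (rule sum.reindex_bij_witness[of _ "\<lambda>j. Suc n - j" "\<lambda>j. Suc n - j"]) auto
  moreover have "j \<in> {1..n}" if "M i (Suc n - j) \<noteq> 0" for i j
  proof -
    have "Suc n - j \<in> {1..n}" using assms that unfolding regular_multigraph_def by blast
    then show ?thesis by auto
  qed
  moreover have "Suc n - j \<in> {1..n}" if "j \<in> {1..n}" for j using that by auto
  ultimately show ?thesis
    using assms by (fastforce simp: regular_multigraph_def)
qed

lemma reflect_reflect:
  assumes "regular_multigraph r n M"
  shows "(\<lambda>i j. M i (Suc n - (Suc n - j))) = M"
proof (intro ext)
  fix i j
  \<comment> \<open>For \<open>j > Suc n\<close> the double truncated subtraction returns
    \<open>Suc n\<close> rather than \<open>j\<close>; both columns are zero.\<close>
  have "M i (Suc n) = 0" "j > Suc n \<Longrightarrow> M i j = 0"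
    using assms by (force simp: regular_multigraph_def)+
  then show "M i (Suc n - (Suc n - j)) = M i j" by (cases "j \<le> Suc n") auto
qed

lemma g_eq_sum_kostka:
  assumes "1 \<le> d" "r * n \<le> N"
  shows "g r n d = (\<Sum>l\<in>shapes d N. kostka d r n l * kostka d r n l)"
proof -
  let ?R = "\<lambda>M :: nat \<Rightarrow> nat \<Rightarrow> nat. \<lambda>i j. M i (Suc n - j)"
  have iff: "L M \<le> d \<longleftrightarrow> (\<forall>k\<ge>d. rsk_shape (?R M) n n k = 0)" if "regular_multigraph r n M" for M
    using L_le_iff_no_chain[of M n d] no_chain_iff_rsk_shape[of "?R M" n d]
      that regular_multigraph_reflect[OF that]
    by (simp add: regular_multigraph_def)
  have "bij_betw ?R {M. regular_multigraph r n M \<and> L M \<le> d} (bounded_regular d r n)"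
    by (rule bij_betw_byWitness[where f' = ?R])
      (auto simp: bounded_regular_def iff reflect_reflect regular_multigraph_reflect)
  then show ?thesis
    unfolding g_def by (simp add: bij_betw_same_card card_bounded_regular[OF assms])
qed

section \<open>Alternating sums of word counts\<close>

text \<open>The possible contents before a last block of \<open>r\<close> letters. A weakly
  decreasing block is determined by its content, so each vector stands for one block; extensionality
  keeps vectors with equal coordinates from being counted repeatedly.\<close>

definition steps :: "nat \<Rightarrow> nat \<Rightarrow> (nat \<Rightarrow> int) \<Rightarrow> (nat \<Rightarrow> int) set" where
  "steps d r x = {x' \<in> extensional {1..d}. (\<forall>j\<in>{1..d}. x' j \<le> x j) \<and>
     (\<Sum>j\<in>{1..d}. x j - x' j) = int r}"

lemma steps_cong: "(\<And>j. j \<in> {1..d} \<Longrightarrow> x j = y j) \<Longrightarrow> steps d r x = steps d r y"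
proof -
  assume eq: "\<And>j. j \<in> {1..d} \<Longrightarrow> x j = y j"
  then have "(\<Sum>j\<in>{1..d}. x j - x' j) = (\<Sum>j\<in>{1..d}. y j - x' j)" for x'
    by (intro sum.cong) auto
  moreover have "(\<forall>j\<in>{1..d}. x' j \<le> x j) \<longleftrightarrow> (\<forall>j\<in>{1..d}. x' j \<le> y j)" for x'
    using eq by simp
  ultimately show ?thesis unfolding steps_def by presburger
qed

lemma steps_ge:
  assumes "x' \<in> steps d r x" "j \<in> {1..d}"
  shows "x j - int r \<le> x' j"
proof -
  have "x j - x' j \<le> (\<Sum>j\<in>{1..d}. x j - x' j)"
    using assms by (intro member_le_sum) (auto simp: steps_def)
  then show ?thesis using assms by (simp add: steps_def)
qed

lemma finite_steps: "finite (steps d r x)"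
proof (rule finite_subset)
  show "steps d r x \<subseteq> PiE {1..d} (\<lambda>j. {x j - int r..x j})"
  proof
    fix x' assume "x' \<in> steps d r x"
    with steps_ge[OF this] show "x' \<in> PiE {1..d} (\<lambda>j. {x j - int r..x j})"
      by (simp add: PiE_iff steps_def)
  qed
  show "finite (PiE {1..d} (\<lambda>j. {x j - int r..x j}))"
    by (intro finite_PiE) auto
qed

lemma steps_shift:
  assumes "x' \<in> steps d r x"
  shows "(\<lambda>j\<in>{1..d}. x' j + c j) \<in> steps d r (\<lambda>j. x j + c j)"
proof -
  have "(\<Sum>j\<in>{1..d}. (x j + c j) - (\<lambda>j\<in>{1..d}. x' j + c j) j) = (\<Sum>j\<in>{1..d}. x j - x' j)"
    by (rule sum.cong) auto
  with assms show ?thesis by (simp add: steps_def)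
qed

text \<open>The coefficient of the monomial with exponents \<open>x\<close> in the
  \<open>n\<close>-th power of the complete homogeneous polynomial of degree \<open>r\<close> in
  \<open>d\<close> variables. Integer exponents allow shifts; the value is 0 at negative
  ones.\<close>

fun wcount :: "nat \<Rightarrow> nat \<Rightarrow> nat \<Rightarrow> (nat \<Rightarrow> int) \<Rightarrow> int" where
  "wcount d r 0 x = (if \<forall>j\<in>{1..d}. x j = 0 then 1 else 0)"
| "wcount d r (Suc n) x = (\<Sum>x'\<in>steps d r x. wcount d r n x')"

lemma wcount_cong:
  assumes "\<And>j. j \<in> {1..d} \<Longrightarrow> x j = y j"
  shows "wcount d r n x = wcount d r n y"
proof (cases n)
  case 0
  with assms show ?thesis by simp
next
  case (Suc m)
  with steps_cong[OF assms] show ?thesis by simp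
qed

lemma wcount_negative:
  assumes "j \<in> {1..d}" "x j < 0"
  shows "wcount d r n x = 0"
  using assms(2)
proof (induction n arbitrary: x)
  case 0
  with assms(1) show ?case by force
next
  case (Suc n)
  have "wcount d r n x' = 0" if "x' \<in> steps d r x" for x'
    using that assms(1) Suc.prems by (intro Suc.IH) (force simp: steps_def)
  then show ?case by simp
qed

lemma steps_permute:
  assumes "s permutes {1..d}" "x' \<in> steps d r x"
  shows "x' \<circ> s \<in> steps d r (x \<circ> s)"
proof -
  have "(\<Sum>j\<in>{1..d}. (x \<circ> s) j - (x' \<circ> s) j) = (\<Sum>j\<in>{1..d}. x j - x' j)"
    using sum.permute[OF assms(1), of "\<lambda>j. x j - x' j"] by (simp add: o_def)
  moreover have "x' \<circ> s \<in> extensional {1..d}"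
    using assms permutes_not_in[OF assms(1)] by (auto simp: steps_def extensional_def)
  ultimately show ?thesis
    using assms permutes_in_image[OF assms(1)] by (simp add: steps_def del: atLeastAtMost_iff)
qed

lemma wcount_permute:
  assumes "s permutes {1..d}"
  shows "wcount d r n (x \<circ> s) = wcount d r n x"
proof (induction n arbitrary: x)
  case 0
  have "(\<forall>j\<in>{1..d}. x (s j) = 0) \<longleftrightarrow> (\<forall>j\<in>s ` {1..d}. x j = 0)" by blast
  then show ?case unfolding permutes_image[OF assms] by simp
next
  case (Suc n)
  have inv: "inv s permutes {1..d}" using assms by (rule permutes_inv)
  have "(\<Sum>x'\<in>steps d r (x \<circ> s). wcount d r n x') = (\<Sum>x'\<in>steps d r x. wcount d r n x')"
  proof (rule sum.reindex_bij_witness[of _ "\<lambda>y. y \<circ> s" "\<lambda>y. y \<circ> inv s"])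
    fix y assume y: "y \<in> steps d r (x \<circ> s)"
    show "y \<circ> inv s \<circ> s = y" by (simp add: o_assoc[symmetric] permutes_inv_o[OF assms])
    show "y \<circ> inv s \<in> steps d r x"
      using steps_permute[OF inv y] by (simp add: o_assoc[symmetric] permutes_inv_o[OF assms])
    show "wcount d r n (y \<circ> inv s) = wcount d r n y"
      using Suc.IH[of "y \<circ> inv s"] by (simp only: o_assoc[symmetric] permutes_inv_o[OF assms] comp_id)
  next
    fix y assume y: "y \<in> steps d r x"
    show "y \<circ> s \<circ> inv s = y" by (simp add: o_assoc[symmetric] permutes_inv_o[OF assms])
    show "y \<circ> s \<in> steps d r (x \<circ> s)" using assms y by (rule steps_permute)
  qed
  then show ?case by (simp only: wcount.simps)
qed

text \<open>This is a coefficient of the product of that power with the Vandermonde determinant. At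
  \<open>y j\<close> equal to the \<open>j\<close>-th part minus \<open>j\<close>, it is the
  multiplicity of the corresponding Schur polynomial.\<close>

definition alternant :: "nat \<Rightarrow> nat \<Rightarrow> nat \<Rightarrow> (nat \<Rightarrow> int) \<Rightarrow> int" where
  "alternant d r n y = (\<Sum>s | s permutes {1..d}. sign s * wcount d r n (\<lambda>j. y j + int (s j)))"

lemma alternant_permute:
  assumes t: "t permutes {1..d}"
  shows "alternant d r n (y \<circ> t) = sign t * alternant d r n y"
proof -
  have "alternant d r n (y \<circ> t) =
      (\<Sum>s | s permutes {1..d}. sign (s \<circ> t) * wcount d r n (\<lambda>j. (y \<circ> t) j + int ((s \<circ> t) j)))"
    unfolding alternant_def by (rule sum_permutations_compose_right[OF t])
  also have "\<dots> = (\<Sum>s | s permutes {1..d}. sign t * (sign s * wcount d r n (\<lambda>j. y j + int (s j))))"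
  proof (rule sum.cong[OF refl])
    fix s assume "s \<in> {s. s permutes {1..d}}"
    then have "sign (s \<circ> t) = sign s * sign t"
      using t permutes_imp_permutation[OF finite_atLeastAtMost] by (intro sign_compose) blast+
    moreover have "wcount d r n (\<lambda>j. (y \<circ> t) j + int ((s \<circ> t) j)) = wcount d r n (\<lambda>j. y j + int (s j))"
      using wcount_permute[OF t, of r n "\<lambda>j. y j + int (s j)"] by (simp add: o_def)
    ultimately show "sign (s \<circ> t) * wcount d r n (\<lambda>j. (y \<circ> t) j + int ((s \<circ> t) j)) =
        sign t * (sign s * wcount d r n (\<lambda>j. y j + int (s j)))" by simp
  qed
  also have "\<dots> = sign t * alternant d r n y"
    by (simp add: alternant_def sum_distrib_left)
  finally show ?thesis .
qed

lemma alternant_transpose: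
  assumes "i \<in> {1..d}" "j \<in> {1..d}" "i \<noteq> j"
  shows "alternant d r n (y \<circ> transpose i j) = - alternant d r n y"
  using alternant_permute[OF permutes_swap_id[OF assms(1,2)], of r n y] assms(3)
  by (simp add: sign_swap_id)

lemma alternant_not_inj:
  assumes "\<not> inj_on y {1..d}"
  shows "alternant d r n y = 0"
proof -
  obtain i j where ij: "i \<in> {1..d}" "j \<in> {1..d}" "i \<noteq> j" "y i = y j"
    using assms by (auto simp: inj_on_def)
  then have "y \<circ> transpose i j = y" by (auto simp: transpose_def)
  with alternant_transpose[OF ij(1-3), of r n y] show ?thesis by simp
qed

lemma alternant_Suc: "alternant d r (Suc n) y = (\<Sum>x\<in>steps d r y. alternant d r n x)"
proof -
  have "wcount d r (Suc n) (\<lambda>j. y j + int (s j)) = (\<Sum>x\<in>steps d r y. wcount d r n (\<lambda>j. x j + int (s j)))" for s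
    unfolding wcount.simps
  proof (rule sum.reindex_bij_witness[of _ "\<lambda>x. \<lambda>j\<in>{1..d}. x j + int (s j)" "\<lambda>x. \<lambda>j\<in>{1..d}. x j - int (s j)"])
    fix x assume x: "x \<in> steps d r (\<lambda>j. y j + int (s j))"
    then have "x \<in> extensional {1..d}" by (simp add: steps_def)
    then show "(\<lambda>j\<in>{1..d}. (\<lambda>j\<in>{1..d}. x j - int (s j)) j + int (s j)) = x"
      by (intro extensionalityI[of _ "{1..d}"]) auto
    show "(\<lambda>j\<in>{1..d}. x j - int (s j)) \<in> steps d r y"
      using steps_shift[OF x, of "\<lambda>j. - int (s j)"] by simp
    show "wcount d r n (\<lambda>j. (\<lambda>j\<in>{1..d}. x j - int (s j)) j + int (s j)) = wcount d r n x"
      by (rule wcount_cong) simp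
  next
    fix x assume x: "x \<in> steps d r y"
    then have "x \<in> extensional {1..d}" by (simp add: steps_def)
    then show "(\<lambda>j\<in>{1..d}. (\<lambda>j\<in>{1..d}. x j + int (s j)) j - int (s j)) = x"
      by (intro extensionalityI[of _ "{1..d}"]) auto
    show "(\<lambda>j\<in>{1..d}. x j + int (s j)) \<in> steps d r (\<lambda>j. y j + int (s j))"
      using x by (rule steps_shift)
  qed
  then have "alternant d r (Suc n) y =
      (\<Sum>s | s permutes {1..d}. \<Sum>x\<in>steps d r y. sign s * wcount d r n (\<lambda>j. x j + int (s j)))"
    by (simp add: alternant_def sum_distrib_left del: wcount.simps)
  also have "\<dots> = (\<Sum>x\<in>steps d r y. alternant d r n x)"
    unfolding alternant_def by (rule sum.swap)
  finally show ?thesis .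
qed

definition strictly_decreasing :: "nat \<Rightarrow> (nat \<Rightarrow> int) \<Rightarrow> bool" where
  "strictly_decreasing d y \<longleftrightarrow> (\<forall>j\<in>{1..<d}. y (Suc j) < y j)"

text \<open>At a violation both \<open>x j\<close> and \<open>x (Suc j)\<close> lie below
  \<open>y (Suc j)\<close>, which lies below \<open>y j\<close>, so either order of the two respects
  the upper bounds.\<close>

lemma steps_swap:
  assumes x: "x \<in> steps d r y" and y: "strictly_decreasing d y"
    and j: "j \<in> {1..<d}" "x j \<le> y (Suc j)"
  shows "x \<circ> transpose j (Suc j) \<in> steps d r y"
proof -
  have tp: "transpose j (Suc j) permutes {1..d}" using j by (intro permutes_swap_id) auto
  have xy: "x i \<le> y i" if "i \<in> {1..d}" for i using x that by (simp add: steps_def)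
  have "x (Suc j) \<le> y (Suc j)" using xy j by simp
  moreover have "y (Suc j) < y j" using y j by (auto simp: strictly_decreasing_def)
  ultimately have le: "(x \<circ> transpose j (Suc j)) i \<le> y i" if "i \<in> {1..d}" for i
    using xy[OF that] j by (auto simp: transpose_def)
  have "x \<circ> transpose j (Suc j) \<in> steps d r (y \<circ> transpose j (Suc j))"
    using steps_permute[OF tp x] .
  moreover have "(\<Sum>i\<in>{1..d}. (y \<circ> transpose j (Suc j)) i) = (\<Sum>i\<in>{1..d}. y i)"
    by (rule sum.permute[OF tp, symmetric])
  ultimately show ?thesis
    using le by (simp add: steps_def sum_subtractf)
qed

text \<open>The surviving steps satisfy \<open>y (Suc j) < x j \<le> y j\<close>, which is
  interlacing in shifted coordinates. Only the last coordinate has no lower bound yet.\<close>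

lemma alternant_pieri:
  assumes y: "strictly_decreasing d y"
  shows "alternant d r (Suc n) y =
    (\<Sum>x | x \<in> steps d r y \<and> (\<forall>j\<in>{1..<d}. y (Suc j) < x j). alternant d r n x)"
proof -
  let ?bad = "\<lambda>x j. j \<in> {1..<d} \<and> x j \<le> y (Suc j)"
  let ?B = "{x \<in> steps d r y. \<exists>j. ?bad x j}"
  let ?m = "\<lambda>x. LEAST j. ?bad x j"
  \<comment> \<open>Swapping at the first violation keeps that violation first, so \<open>?f\<close> is an involution on \<open>?B\<close>;
    it changes the sign of the alternant.\<close>
  let ?f = "\<lambda>x. x \<circ> transpose (?m x) (Suc (?m x))"
  have m: "?bad x (?m x)" if "x \<in> ?B" for x
    by (rule LeastI_ex) (use that in simp)
  have tp: "transpose (?m x) (Suc (?m x)) permutes {1..d}" if "x \<in> ?B" for x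
    using m[OF that] by (intro permutes_swap_id) auto
  have fm: "?m (?f x) = ?m x" if x: "x \<in> ?B" for x
  proof (rule Least_equality)
    have "x (Suc (?m x)) \<le> y (Suc (?m x))" using x m[OF x] by (auto simp: steps_def)
    then show "?bad (?f x) (?m x)" using m[OF x] by simp
    show "?m x \<le> j" if j: "?bad (?f x) j" for j
    proof (rule ccontr)
      assume "\<not> ?m x \<le> j"
      then have "j < ?m x" by simp
      then have "?f x j = x j" by (simp add: transpose_def)
      with j have "?bad x j" by simp
      with \<open>j < ?m x\<close> show False using not_less_Least[of j "?bad x"] by blast
    qed
  qed
  have fB: "?f x \<in> ?B" if x: "x \<in> ?B" for x
  proof -
    have j: "?bad x (?m x)" using m[OF x] .
    have "x (Suc (?m x)) \<le> y (Suc (?m x))" using x j by (auto simp: steps_def)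
    then have "?bad (?f x) (?m x)" using j by simp
    moreover have "?f x \<in> steps d r y"
      using x j by (intro steps_swap[OF _ y]) auto
    ultimately show ?thesis by blast
  qed
  have ff: "?f (?f x) = x" if "x \<in> ?B" for x
    by (simp only: fm[OF that] o_assoc[symmetric] transpose_comp_involutory comp_id)
  have neg: "alternant d r n (?f x) = - alternant d r n x" if "x \<in> ?B" for x
    using m[OF that] by (intro alternant_transpose) auto
  have "(\<Sum>x\<in>?B. alternant d r n x) = (\<Sum>x\<in>?B. - alternant d r n x)"
    by (rule sum.reindex_bij_witness[of _ ?f ?f]) (use ff fB neg in auto)
  then have "(\<Sum>x\<in>?B. alternant d r n x) = 0"
    by (simp add: sum_negf)
  moreover have "(\<Sum>x\<in>steps d r y. alternant d r n x) = (\<Sum>x\<in>?B. alternant d r n x) +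
      (\<Sum>x | x \<in> steps d r y \<and> (\<forall>j\<in>{1..<d}. y (Suc j) < x j). alternant d r n x)"
    using finite_steps[of d r y]
    by (subst sum.union_disjoint[symmetric]) (force intro!: sum.cong simp: not_less)+
  ultimately show ?thesis
    unfolding alternant_Suc by simp
qed

section \<open>The Jacobi--Trudi identity and block words\<close>

text \<open>Partitions have parts \<open>l 0 \<ge> l 1 \<ge> \<dots>\<close>, whereas walk coordinates are numbered from 1.\<close>
definition shifted :: "nat \<Rightarrow> (nat \<Rightarrow> nat) \<Rightarrow> nat \<Rightarrow> int" where
  "shifted d l = (\<lambda>j\<in>{1..d}. int (l (j - 1)) - int j)"

definition unshifted :: "nat \<Rightarrow> (nat \<Rightarrow> int) \<Rightarrow> nat \<Rightarrow> nat" where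
  "unshifted d x k = (if k < d then nat (x (Suc k) + int (Suc k)) else 0)"

lemma unshifted_shifted: "(\<And>k. d \<le> k \<Longrightarrow> l k = 0) \<Longrightarrow> unshifted d (shifted d l) = l"
  by (auto simp: fun_eq_iff unshifted_def shifted_def)

lemma shifted_unshifted:
  assumes "x \<in> extensional {1..d}" "\<And>j. j \<in> {1..d} \<Longrightarrow> 0 \<le> x j + int j"
  shows "shifted d (unshifted d x) = x"
proof (rule extensionalityI[of _ "{1..d}"])
  fix j assume j: "j \<in> {1..d}"
  then have "Suc (j - 1) = j" "j - 1 < d" by auto
  with assms(2)[OF j] j show "shifted d (unshifted d x) j = x j"
    by (simp add: shifted_def unshifted_def)
qed (use assms in \<open>auto simp: shifted_def\<close>)

lemma strictly_decreasing_shifted: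
  assumes "\<And>k. l (Suc k) \<le> l k"
  shows "strictly_decreasing d (shifted d l)"
  unfolding strictly_decreasing_def
proof
  fix j assume "j \<in> {1..<d}"
  moreover from this have "l j \<le> l (j - 1)" using assms[of "j - 1"] by simp
  ultimately show "shifted d l (Suc j) < shifted d l j" by (simp add: shifted_def)
qed

text \<open>Supplies the lower bound missing in \<open>alternant_pieri\<close>: as
  \<open>s d \<le> d\<close>, every term is a word count with a negative coordinate.\<close>

lemma alternant_negative:
  assumes "1 \<le> d" "x d < - int d"
  shows "alternant d r n x = 0"
  unfolding alternant_def
proof (rule sum.neutral, rule ballI)
  fix s assume "s \<in> {s. s permutes {1..d}}"
  then have "s d \<in> {1..d}" using permutes_in_image[of s "{1..d}" d] assms(1) by simp
  then have "wcount d r n (\<lambda>j. x j + int (s j)) = 0"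
    using assms by (intro wcount_negative[of d]) auto
  then show "sign s * wcount d r n (\<lambda>j. x j + int (s j)) = 0" by simp
qed

text \<open>Subtracting the index turns the weak inequality \<open>l j \<le> v (j - 1)\<close> into
  a strict one, so horizontal strips become exactly the steps that survive in the Pieri
  rule.\<close>

lemma shifted_lower_shapes:
  assumes l: "\<And>k. d \<le> k \<Longrightarrow> l k = 0"
    and v: "v \<in> lower_shapes d r l"
  shows "shifted d v \<in> steps d r (shifted d l)" "\<forall>j\<in>{1..<d}. shifted d l (Suc j) < shifted d v j"
proof -
  have i: "v k \<le> l k" "l (Suc k) \<le> v k" for k
    using v by (auto simp: lower_shapes_def interlace_def)
  have "(\<Sum>j\<in>{1..d}. shifted d l j - shifted d v j) = (\<Sum>j=Suc 0..d. int (l (j - 1)) - int (v (j - 1)))"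
    by (rule sum.cong) (auto simp: shifted_def)
  also have "\<dots> = (\<Sum>k<d. int (l k) - int (v k))"
    by (subst sum.atLeast1_atMost_eq) simp
  also have "\<dots> = int (size_upto d l) - int (size_upto d v)"
    by (simp add: size_upto_def sum_subtractf)
  also have "\<dots> = int r" using v by (simp add: lower_shapes_def)
  finally show "shifted d v \<in> steps d r (shifted d l)"
    using i by (simp add: steps_def shifted_def)
  show "\<forall>j\<in>{1..<d}. shifted d l (Suc j) < shifted d v j"
  proof
    fix j assume "j \<in> {1..<d}"
    moreover from this have "l j \<le> v (j - 1)" using i(2)[of "j - 1"] by simp
    ultimately show "shifted d l (Suc j) < shifted d v j" by (simp add: shifted_def)
  qed
qed

lemma unshifted_lower_shapes:
  assumes l: "\<And>k. d \<le> k \<Longrightarrow> l k = 0"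
    and x: "x \<in> steps d r (shifted d l)" "\<forall>j\<in>{1..<d}. shifted d l (Suc j) < x j"
    and "- int d \<le> x d"
  shows "unshifted d x \<in> lower_shapes d r l" "shifted d (unshifted d x) = x"
proof -
  \<comment> \<open>For \<open>j < d\<close> the bound comes from interlacing; for
    \<open>j = d\<close> it comes from the assumption on \<open>x d\<close> together with
    \<open>l d = 0\<close>.\<close>
  have ge: "int (l j) \<le> x j + int j" if "j \<in> {1..d}" for j
  proof (cases "j = d")
    case True
    with assms(4) l[of d] show ?thesis by simp
  next
    case False
    with x(2) that have "shifted d l (Suc j) < x j" by simp
    with that False show ?thesis by (simp add: shifted_def)
  qed
  have "0 \<le> x j + int j" if "j \<in> {1..d}" for j
    using ge[OF that] by simp
  moreover have ext: "x \<in> extensional {1..d}" using x(1) by (simp add: steps_def)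
  ultimately show eq: "shifted d (unshifted d x) = x"
    by (intro shifted_unshifted) auto
  have il: "unshifted d x k \<le> l k \<and> l (Suc k) \<le> unshifted d x k" for k
  proof (cases "k < d")
    case True
    then have "x (Suc k) \<le> shifted d l (Suc k)" using x(1) by (simp add: steps_def)
    with True ge[of "Suc k"] show ?thesis by (simp add: unshifted_def shifted_def) linarith
  next
    case False
    then show ?thesis using l[of "Suc k"] by (simp add: unshifted_def)
  qed
  let ?v = "unshifted d x"
  have "int r = (\<Sum>j\<in>{1..d}. shifted d l j - shifted d ?v j)"
    using x(1) unfolding eq by (simp add: steps_def)
  also have "\<dots> = (\<Sum>j=Suc 0..d. int (l (j - 1)) - int (?v (j - 1)))"
    by (rule sum.cong) (auto simp: shifted_def)
  also have "\<dots> = (\<Sum>k<d. int (l k) - int (?v k))"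
    by (subst sum.atLeast1_atMost_eq) simp
  also have "\<dots> = int (size_upto d l) - int (size_upto d ?v)"
    by (simp add: size_upto_def sum_subtractf)
  finally show "?v \<in> lower_shapes d r l"
    using il by (simp add: lower_shapes_def interlace_def)
qed

lemma alternant_shifted:
  assumes "1 \<le> d" "\<And>k. l (Suc k) \<le> l k" "\<And>k. d \<le> k \<Longrightarrow> l k = 0"
  shows "alternant d r n (shifted d l) = int (kostka d r n l)"
  using assms(2,3)
proof (induction n arbitrary: l)
  case 0
  have summand: "sign s * wcount d r 0 (\<lambda>j. shifted d l j + int (s j)) =
      (if s = id then (if l = (\<lambda>_. 0) then 1 else 0) else 0)"
    if s: "s permutes {1..d}" for s
  proof (cases "\<forall>j\<in>{1..d}. shifted d l j + int (s j) = 0")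
    case True
    \<comment> \<open>A nonzero term forces \<open>s j \<le> j\<close> for all \<open>j\<close>,
      which only the identity satisfies; the equation then gives \<open>l = 0\<close>.\<close>
    then have eq: "int (s j) = int j - int (l (j - 1))" if "j \<in> {1..d}" for j
      using that by (force simp: shifted_def)
    then have "s j \<le> j" if "j \<in> {1..d}" for j
      using that by fastforce
    then have id: "s = id" using permutes_natset_le[OF s] by blast
    have "l k = 0" for k
      using eq[of "Suc k"] id 0(2)[of k] by (cases "k < d") auto
    with id True show ?thesis by auto
  next
    case False
    then have "\<not> (s = id \<and> l = (\<lambda>_. 0))" by (auto simp: shifted_def)
    with False show ?thesis by auto
  qed
  have "alternant d r 0 (shifted d l) =
      (\<Sum>s | s permutes {1..d}. if s = id then (if l = (\<lambda>_. 0) then 1 else 0) else 0)"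
    unfolding alternant_def using summand by (intro sum.cong) auto
  also have "\<dots> = int (kostka d r 0 l)"
    by (subst sum.delta) (auto simp: finite_permutations permutes_id)
  finally show ?case .
next
  case (Suc n)
  let ?G = "{x. x \<in> steps d r (shifted d l) \<and> (\<forall>j\<in>{1..<d}. shifted d l (Suc j) < x j)}"
  have fin: "finite ?G" using finite_steps[of d r "shifted d l"] by simp
  have "alternant d r (Suc n) (shifted d l) = (\<Sum>x\<in>?G. alternant d r n x)"
    using Suc.prems by (intro alternant_pieri strictly_decreasing_shifted)
  \<comment> \<open>The discarded steps would make the last part negative; the remaining ones are
    the shapes in the recursion of \<open>kostka\<close>.\<close>
  also have "\<dots> = (\<Sum>x | x \<in> ?G \<and> - int d \<le> x d. alternant d r n x)"
  proof (rule sum.mono_neutral_right)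
    show "\<forall>x\<in>?G - {x \<in> ?G. - int d \<le> x d}. alternant d r n x = 0"
      using alternant_negative[OF assms(1)] by (force simp: not_le)
  qed (use fin in auto)
  also have "\<dots> = (\<Sum>v\<in>lower_shapes d r l. int (kostka d r n v))"
  proof (rule sum.reindex_bij_witness[of _ "shifted d" "unshifted d"])
    fix x assume "x \<in> {x \<in> ?G. - int d \<le> x d}"
    then have x: "x \<in> steps d r (shifted d l)" "\<forall>j\<in>{1..<d}. shifted d l (Suc j) < x j" "- int d \<le> x d"
      by auto
    note u = unshifted_lower_shapes[OF Suc.prems(2) x]
    show "shifted d (unshifted d x) = x" "unshifted d x \<in> lower_shapes d r l"
      using u by simp_all
    have "interlace (unshifted d x) l" using u(1) by (simp add: lower_shapes_def)
    then have "unshifted d x (Suc k) \<le> unshifted d x k" for k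
      unfolding interlace_def by (meson order_trans)
    moreover have "unshifted d x k = 0" if "d \<le> k" for k using that by (simp add: unshifted_def)
    ultimately have "alternant d r n (shifted d (unshifted d x)) = int (kostka d r n (unshifted d x))"
      by (rule Suc.IH)
    then show "int (kostka d r n (unshifted d x)) = alternant d r n x" by (simp add: u(2))
  next
    fix v assume v: "v \<in> lower_shapes d r l"
    have z: "v k = 0" if "d \<le> k" for k
      using lower_shapes_zero_beyond[OF Suc.prems(2) v that] .
    then show "unshifted d (shifted d v) = v" by (rule unshifted_shifted)
    have "- int d \<le> shifted d v d" using assms(1) by (simp add: shifted_def)
    then show "shifted d v \<in> {x \<in> ?G. - int d \<le> x d}"
      using shifted_lower_shapes[OF Suc.prems(2) v] by auto
  qed
  finally show ?case by simp
qed

section \<open>Block words and their contents\<close>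

definition decreasing_list :: "nat \<Rightarrow> (nat \<Rightarrow> nat) \<Rightarrow> nat list" where
  "decreasing_list d c = rev (concat (map (\<lambda>j. replicate (c j) j) [1..<Suc d]))"

lemma count_list_replicate: "count_list (replicate n x) y = (if x = y then n else 0)"
  by (induction n) auto

lemma count_list_concat_replicate:
  "count_list (concat (map (\<lambda>j. replicate (c j) j) [1..<Suc d])) j = (if j \<in> {1..d} then c j else 0)"
  by (induction d) (auto simp: count_list_replicate)

lemma count_list_decreasing_list:
  "count_list (decreasing_list d c) j = (if j \<in> {1..d} then c j else 0)"
  unfolding decreasing_list_def count_list_rev by (rule count_list_concat_replicate)

lemma set_decreasing_list: "set (decreasing_list d c) \<subseteq> {1..d}"
  by (auto simp: decreasing_list_def)

lemma length_decreasing_list: "length (decreasing_list d c) = (\<Sum>j\<in>{1..d}. c j)"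
proof -
  have "length (concat (map (\<lambda>j. replicate (c j) j) [1..<Suc d])) = (\<Sum>j\<in>{1..d}. c j)"
    by (induction d) auto
  then show ?thesis by (simp add: decreasing_list_def del: upt_Suc)
qed

lemma sorted_decreasing_list: "sorted_wrt (\<ge>) (decreasing_list d c)"
proof -
  have "sorted (concat (map (\<lambda>j. replicate (c j) j) [1..<Suc d]))"
    by (induction d) (auto simp: sorted_append)
  then show ?thesis unfolding decreasing_list_def sorted_wrt_rev by simp
qed

lemma sorted_eq_decreasing_list:
  assumes "sorted_wrt (\<ge>) b" "set b \<subseteq> {1..d}" "\<And>j. j \<in> {1..d} \<Longrightarrow> count_list b j = c j"
  shows "b = decreasing_list d c"
proof -
  have "count_list b j = count_list (decreasing_list d c) j" for j
    using assms(2,3) by (cases "j \<in> {1..d}") (auto simp: count_list_decreasing_list count_list_0_iff)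
  then have "mset (rev b) = mset (rev (decreasing_list d c))"
    by (intro multiset_eqI) (simp add: count_mset)
  moreover have "sorted (rev b)" "sorted (rev (decreasing_list d c))"
    using assms(1) sorted_decreasing_list[of d c] by (simp_all add: sorted_wrt_rev)
  ultimately show ?thesis
    by (metis properties_for_sort rev_rev_ident)
qed

lemma sum_count_list:
  fixes b :: "nat list"
  assumes "set b \<subseteq> {1..d}"
  shows "(\<Sum>j\<in>{1..d}. count_list b j) = length b"
  using sum_count_set[OF assms finite_atLeastAtMost] .

definition block_words :: "nat \<Rightarrow> nat \<Rightarrow> nat \<Rightarrow> nat list set" where
  "block_words d r n = {a. length a = r * n \<and> set a \<subseteq> {1..d} \<and>
     (\<forall>i\<in>{1..n}. \<forall>s\<in>{1..<r}. a ! (r * (i - 1) + s - 1) \<ge> a ! (r * (i - 1) + s))}"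

lemma block_words_Suc:
  assumes "length a = r * n" "length b = r"
  shows "a @ b \<in> block_words d r (Suc n) \<longleftrightarrow>
    a \<in> block_words d r n \<and> set b \<subseteq> {1..d} \<and> sorted_wrt (\<ge>) b"
proof -
  have 1: "(a @ b) ! (r * (i - 1) + s - 1) = a ! (r * (i - 1) + s - 1) \<and>
      (a @ b) ! (r * (i - 1) + s) = a ! (r * (i - 1) + s)"
    if "i \<in> {1..n}" "s \<in> {1..<r}" for i s
  proof -
    have "r * (i - 1) + s < r * (i - 1) + r" using that by simp
    also have "\<dots> = r * i" using that by (cases i) auto
    also have "\<dots> \<le> r * n" using that by simp
    finally have "r * (i - 1) + s < length a" using assms by simp
    moreover from this have "r * (i - 1) + s - 1 < length a" by simp
    ultimately show ?thesis by (simp only: nth_append if_True)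
  qed
  have 2: "(a @ b) ! (r * (Suc n - 1) + s - 1) = b ! (s - 1) \<and> (a @ b) ! (r * (Suc n - 1) + s) = b ! s"
    if "s \<in> {1..<r}" for s
    using that assms by (auto simp: nth_append)
  have 3: "sorted_wrt (\<ge>) b \<longleftrightarrow> (\<forall>s\<in>{1..<r}. b ! (s - 1) \<ge> b ! s)"
  proof -
    have "sorted_wrt (\<ge>) b \<longleftrightarrow> (\<forall>i. Suc i < r \<longrightarrow> b ! i \<ge> b ! Suc i)"
      using assms(2) by (simp add: sorted_wrt_iff_nth_Suc_transp transp_on_def)
    also have "\<dots> \<longleftrightarrow> (\<forall>s\<in>{1..<r}. b ! (s - 1) \<ge> b ! s)"
    proof (intro iffI ballI)
      fix s assume "\<forall>i. Suc i < r \<longrightarrow> b ! i \<ge> b ! Suc i" "s \<in> {1..<r}"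
      then show "b ! (s - 1) \<ge> b ! s" by (cases s) auto
    next
      assume *: "\<forall>s\<in>{1..<r}. b ! (s - 1) \<ge> b ! s"
      show "\<forall>i. Suc i < r \<longrightarrow> b ! i \<ge> b ! Suc i"
      proof (intro allI impI)
        fix i assume "Suc i < r"
        then show "b ! i \<ge> b ! Suc i" using *[rule_format, of "Suc i"] by simp
      qed
    qed
    finally show ?thesis .
  qed
  have 4: "{1..Suc n} = insert (Suc n) {1..n}" by auto
  show ?thesis
    unfolding block_words_def mem_Collect_eq 3 4 ball_simps(7)
    using assms 1 2 by auto
qed

definition content_words :: "nat \<Rightarrow> nat \<Rightarrow> nat \<Rightarrow> (nat \<Rightarrow> int) \<Rightarrow> nat list set" where
  "content_words d r n x = {a \<in> block_words d r n. \<forall>j\<in>{1..d}. int (count_list a j) = x j}"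

lemma finite_content_words: "finite (content_words d r n x)"
proof (rule finite_subset)
  show "content_words d r n x \<subseteq> {a. set a \<subseteq> {1..d} \<and> length a = r * n}"
    by (auto simp: content_words_def block_words_def)
qed (simp add: finite_lists_length_eq)

text \<open>A word is cut before its last block. Once the content \<open>x'\<close> of the prefix is
  known, that block must be the decreasing list with content \<open>x - x'\<close>, so only the
  prefix remains free.\<close>

lemma card_content_words: "int (card (content_words d r n x)) = wcount d r n x"
proof (induction n arbitrary: x)
  case 0
  have "content_words d r 0 x = (if \<forall>j\<in>{1..d}. x j = 0 then {[]} else {})"
    by (auto simp: content_words_def block_words_def)
  then show ?case by simp
next
  case (Suc n)
  let ?b = "\<lambda>x'. decreasing_list d (\<lambda>j. nat (x j - x' j))"
  let ?S = "\<lambda>x'. (\<lambda>a. a @ ?b x') ` content_words d r n x'"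
  have len: "length (?b x') = r" if "x' \<in> steps d r x" for x'
  proof -
    have "int (length (?b x')) = (\<Sum>j\<in>{1..d}. x j - x' j)"
      using that unfolding length_decreasing_list of_nat_sum
      by (intro sum.cong) (auto simp: steps_def)
    then show ?thesis using that by (simp add: steps_def)
  qed
  have eq: "content_words d r (Suc n) x = (\<Union>x'\<in>steps d r x. ?S x')"
  proof (intro equalityI subsetI)
    fix w assume w: "w \<in> content_words d r (Suc n) x"
    define a b where "a = take (r * n) w" and "b = drop (r * n) w"
    have ab: "w = a @ b" "length a = r * n" "length b = r"
      using w by (auto simp: a_def b_def content_words_def block_words_def)
    with w have bw: "a \<in> block_words d r n" "set b \<subseteq> {1..d}" "sorted_wrt (\<ge>) b"
      using block_words_Suc[of a r n b d] by (auto simp: content_words_def)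
    define x' where "x' = (\<lambda>j\<in>{1..d}. int (count_list a j))"
    have xj: "x j = int (count_list a j) + int (count_list b j)" if "j \<in> {1..d}" for j
      using w that ab(1) by (simp add: content_words_def)
    have "(\<Sum>j\<in>{1..d}. x j - x' j) = (\<Sum>j\<in>{1..d}. int (count_list b j))"
      by (rule sum.cong) (auto simp: xj x'_def)
    also have "\<dots> = int r" using sum_count_list[OF bw(2)] ab(3) by (simp flip: of_nat_sum)
    finally have st: "x' \<in> steps d r x"
      using xj by (simp add: steps_def x'_def)
    have "b = ?b x'"
      using bw xj by (intro sorted_eq_decreasing_list) (auto simp: x'_def)
    moreover have "a \<in> content_words d r n x'" using bw by (simp add: content_words_def x'_def)
    ultimately show "w \<in> (\<Union>x'\<in>steps d r x. ?S x')" using st ab(1) by blast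
  next
    fix w assume "w \<in> (\<Union>x'\<in>steps d r x. ?S x')"
    then obtain x' a where x': "x' \<in> steps d r x" and a: "a \<in> content_words d r n x'" and w: "w = a @ ?b x'"
      by blast
    have "w \<in> block_words d r (Suc n)"
      unfolding w using a len[OF x'] set_decreasing_list sorted_decreasing_list
      by (subst block_words_Suc) (auto simp: content_words_def block_words_def)
    moreover have "int (count_list w j) = x j" if "j \<in> {1..d}" for j
      using a x' that unfolding w by (simp add: content_words_def count_list_decreasing_list steps_def)
    ultimately show "w \<in> content_words d r (Suc n) x" by (simp add: content_words_def)
  qed
  have disj: "?S x' \<inter> ?S x'' = {}" if x: "x' \<in> steps d r x" "x'' \<in> steps d r x" "x' \<noteq> x''" for x' x''
  proof (rule equals0I)
    fix w assume "w \<in> ?S x' \<inter> ?S x''"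
    then obtain a b where ab: "a \<in> content_words d r n x'" "b \<in> content_words d r n x''"
      "w = a @ ?b x'" "w = b @ ?b x''" by blast
    then have "a = b"
      by (auto simp: content_words_def block_words_def)
    with ab have "x' = x''"
      using x by (intro extensionalityI[of _ "{1..d}"]) (auto simp: content_words_def steps_def)
    with x show False by simp
  qed
  have "card (\<Union>x'\<in>steps d r x. ?S x') = (\<Sum>x'\<in>steps d r x. card (?S x'))"
    by (intro card_UN_disjoint ballI impI finite_imageI finite_steps finite_content_words disj)
  also have "\<dots> = (\<Sum>x'\<in>steps d r x. card (content_words d r n x'))"
    by (intro sum.cong card_image) (auto simp: inj_on_def)
  finally show ?case by (simp add: eq Suc.IH)
qed

section \<open>Signed walk counts as a sum of squares\<close>

text \<open>Large enough to contain every \<open>z\<close> for which \<open>wcount d r n\<close> does not vanish at \<open>z + p\<close>,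
  where \<open>p\<close> permutes \<open>{1..d}\<close> and \<open>N = r * n\<close>.\<close>
definition box :: "nat \<Rightarrow> nat \<Rightarrow> (nat \<Rightarrow> int) set" where
  "box d N = PiE {1..d} (\<lambda>_. {- int d..int N})"

lemma finite_box: "finite (box d N)"
  unfolding box_def by (intro finite_PiE) auto

text \<open>The endpoint condition says that \<open>count_list a j - j\<close> and
  \<open>count_list b j - p j\<close> agree as integers. Fixing their common value
  \<open>z j\<close> makes the two words independent.\<close>

lemma card_Wprime_toeplitz:
  assumes p: "p permutes {1..d}"
  shows "int (card (Wprime r n d (toeplitz p))) =
    (\<Sum>z\<in>box d (r * n). wcount d r n (\<lambda>j. z j + int j) * wcount d r n (\<lambda>j. z j + int (p j)))"
proof -
  let ?S = "\<lambda>z. content_words d r n (\<lambda>j. z j + int j) \<times> content_words d r n (\<lambda>j. z j + int (p j))"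
  have eq: "Wprime r n d (toeplitz p) = (\<Union>z\<in>box d (r * n). ?S z)"
  proof (intro equalityI subsetI)
    fix w assume w: "w \<in> Wprime r n d (toeplitz p)"
    obtain a b where ab: "w = (a, b)" by (cases w)
    define z where "z = (\<lambda>j\<in>{1..d}. int (count_list b j) - int (p j))"
    have bw: "a \<in> block_words d r n" "b \<in> block_words d r n"
      using w ab by (auto simp: Wprime_def block_words_def)
    have cnt: "int (count_list a j) - int (count_list b j) = int j - int (p j)" if "j \<in> {1..d}" for j
      using w ab that by (simp add: Wprime_def toeplitz_def)
    have "z j \<in> {- int d..int (r * n)}" if "j \<in> {1..d}" for j
    proof -
      have "p j \<le> d" using permutes_in_image[OF p, of j] that by simp
      moreover have "count_list b j \<le> r * n"
        using count_le_length[of b j] bw by (simp add: block_words_def)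
      ultimately show ?thesis using that by (simp add: z_def flip: of_nat_mult)
    qed
    then have "z \<in> box d (r * n)" by (auto simp: box_def z_def)
    moreover have "w \<in> ?S z"
      using bw cnt by (force simp: ab content_words_def z_def)
    ultimately show "w \<in> (\<Union>z\<in>box d (r * n). ?S z)" by blast
  next
    fix w assume "w \<in> (\<Union>z\<in>box d (r * n). ?S z)"
    then show "w \<in> Wprime r n d (toeplitz p)"
      by (auto simp: content_words_def block_words_def Wprime_def toeplitz_def)
  qed
  have disj: "?S z \<inter> ?S z' = {}" if z: "z \<in> box d (r * n)" "z' \<in> box d (r * n)" "z \<noteq> z'" for z z'
  proof (rule equals0I)
    fix w assume "w \<in> ?S z \<inter> ?S z'"
    then have "z j = z' j" if "j \<in> {1..d}" for j
      using that by (force simp: content_words_def)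
    then have "z = z'"
      using z by (intro PiE_ext[of z "{1..d}" _ z']) (auto simp: box_def)
    with z show False by simp
  qed
  have "card (\<Union>z\<in>box d (r * n). ?S z) = (\<Sum>z\<in>box d (r * n). card (?S z))"
    by (intro card_UN_disjoint ballI impI finite_box finite_cartesian_product finite_content_words disj)
  then show ?thesis
    by (simp add: eq card_cartesian_product card_content_words)
qed

section \<open>Strictly decreasing representatives of injective vectors\<close>

lemma strictly_decreasing_less:
  assumes "strictly_decreasing d y" "1 \<le> i" "i < j" "j \<le> d"
  shows "y j < y i"
  using assms(3,4)
proof (induction j)
  case (Suc j)
  then have "y (Suc j) < y j" using assms by (simp add: strictly_decreasing_def)
  with Suc show ?case by (cases "i = j") auto
qed simp

text \<open>Since \<open>y\<close> reverses order, \<open>y \<circ> s\<close> can decrease only if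
  \<open>s\<close> increases on \<open>{1..d}\<close>, and the only such permutation is the
  identity.\<close>

lemma strictly_decreasing_unique:
  assumes y: "strictly_decreasing d y" and y': "strictly_decreasing d (y \<circ> s)"
    and s: "s permutes {1..d}"
  shows "s = id"
proof -
  have in_range: "s j \<in> {1..d}" if "j \<in> {1..d}" for j using permutes_in_image[OF s] that by blast
  have mono: "s j < s (Suc j)" if "j \<in> {1..<d}" for j
  proof (rule ccontr)
    assume "\<not> s j < s (Suc j)"
    moreover have "s j \<noteq> s (Suc j)" using permutes_inj[OF s] by (metis injD n_not_Suc_n)
    ultimately have "s (Suc j) < s j" by simp
    then have "y (s j) < y (s (Suc j))"
      using in_range[of j] in_range[of "Suc j"] that by (intro strictly_decreasing_less[OF y]) auto
    moreover have "y (s (Suc j)) < y (s j)"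
      using y' that by (simp add: strictly_decreasing_def)
    ultimately show False by simp
  qed
  have "j \<in> {1..d} \<longrightarrow> j \<le> s j" for j
  proof (induction j)
    case (Suc j)
    show ?case
    proof (cases "j = 0")
      case True
      then show ?thesis using in_range[of "Suc j"] by auto
    next
      case False
      then show ?thesis using Suc mono[of j] by auto
    qed
  qed simp
  then show ?thesis using permutes_natset_ge[OF s] by blast
qed

lemma ex_strictly_decreasing:
  assumes "inj_on z {1..d}"
  shows "\<exists>s. s permutes {1..d} \<and> strictly_decreasing d (z \<circ> s)"
proof -
  define xs where "xs = rev (sorted_list_of_set (z ` {1..d}))"
  have len: "length xs = d" and set: "set xs = z ` {1..d}" and dist: "distinct xs"
    using assms by (simp_all add: xs_def card_image)
  have dec: "sorted_wrt (>) xs"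
    by (simp add: xs_def sorted_wrt_rev)
  define s where "s j = (if j \<in> {1..d} then inv_into {1..d} z (xs ! (j - 1)) else j)" for j
  have mem: "xs ! (j - 1) \<in> z ` {1..d}" if "j \<in> {1..d}" for j
    using that len set[symmetric] by auto
  have zs: "z (s j) = xs ! (j - 1)" "s j \<in> {1..d}" if "j \<in> {1..d}" for j
    using f_inv_into_f[OF mem[OF that]] inv_into_into[OF mem[OF that]] that by (simp_all add: s_def)
  have "inj_on s {1..d}"
  proof (rule inj_onI)
    fix i j assume ij: "i \<in> {1..d}" "j \<in> {1..d}" "s i = s j"
    then have "xs ! (i - 1) = xs ! (j - 1)" using zs(1) by metis
    then have "i - 1 = j - 1" using ij len dist by (subst (asm) nth_eq_iff_index_eq) auto
    then show "i = j" using ij by auto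
  qed
  moreover have "s ` {1..d} \<subseteq> {1..d}" using zs(2) by blast
  ultimately have "bij_betw s {1..d} {1..d}"
    by (simp add: bij_betw_def endo_inj_surj)
  then have "s permutes {1..d}"
    by (rule bij_imp_permutes) (simp only: s_def if_False)
  moreover have "strictly_decreasing d (z \<circ> s)"
    unfolding strictly_decreasing_def
  proof
    fix j assume "j \<in> {1..<d}"
    then show "(z \<circ> s) (Suc j) < (z \<circ> s) j"
      using zs(1)[of j] zs(1)[of "Suc j"] sorted_wrt_nth_less[OF dec, of "j - 1" j] len by auto
  qed
  ultimately show ?thesis by blast
qed

lemma box_permute:
  assumes "s permutes {1..d}" "z \<in> box d N"
  shows "z \<circ> s \<in> box d N"
  using assms permutes_in_image[OF assms(1)] permutes_not_in[OF assms(1)]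
  by (auto simp: box_def PiE_iff extensional_def simp del: atLeastAtMost_iff)

lemma bij_betw_strictly_decreasing:
  "bij_betw (\<lambda>(y, s). y \<circ> s)
     ({y \<in> box d N. strictly_decreasing d y} \<times> {s. s permutes {1..d}})
     {z \<in> box d N. inj_on z {1..d}}"
  unfolding bij_betw_def
proof
  show "inj_on (\<lambda>(y, s). y \<circ> s) ({y \<in> box d N. strictly_decreasing d y} \<times> {s. s permutes {1..d}})"
  proof (rule inj_onI, clarify)
    fix y s y' s'
    assume y: "strictly_decreasing d y" "strictly_decreasing d y'"
      and s: "s permutes {1..d}" "s' permutes {1..d}" and eq: "y \<circ> s = y' \<circ> s'"
    have "y = y \<circ> s \<circ> inv s" by (simp only: o_assoc[symmetric] permutes_inv_o[OF s(1)] comp_id)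
    then have yy: "y = y' \<circ> (s' \<circ> inv s)" using eq by (simp add: o_assoc)
    then have "s' \<circ> inv s = id"
      using y s by (intro strictly_decreasing_unique[of d y']) (auto intro: permutes_compose permutes_inv)
    then have "s' = s"
      by (metis comp_id o_assoc permutes_inv_o(2)[OF s(1)] id_comp)
    with yy \<open>s' \<circ> inv s = id\<close> show "y = y' \<and> s = s'" by simp
  qed
next
  show "(\<lambda>(y, s). y \<circ> s) ` ({y \<in> box d N. strictly_decreasing d y} \<times> {s. s permutes {1..d}}) =
      {z \<in> box d N. inj_on z {1..d}}"
  proof (intro equalityI subsetI)
    fix z assume "z \<in> (\<lambda>(y, s). y \<circ> s) ` ({y \<in> box d N. strictly_decreasing d y} \<times> {s. s permutes {1..d}})"
    then obtain y s where y: "y \<in> box d N" "strictly_decreasing d y" and s: "s permutes {1..d}"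
      and z: "z = y \<circ> s" by auto
    have "inj_on y {1..d}"
      by (rule linorder_inj_onI) (use strictly_decreasing_less[OF y(2)] in force)+
    then have "inj_on z {1..d}"
      unfolding z using permutes_inj_on[OF s] permutes_image[OF s] by (intro comp_inj_on) auto
    with box_permute[OF s y(1)] z show "z \<in> {z \<in> box d N. inj_on z {1..d}}" by simp
  next
    fix z assume z: "z \<in> {z \<in> box d N. inj_on z {1..d}}"
    then obtain s where s: "s permutes {1..d}" "strictly_decreasing d (z \<circ> s)"
      using ex_strictly_decreasing by blast
    have "z = (\<lambda>(y, s). y \<circ> s) (z \<circ> s, inv s)"
      by (simp only: prod.case o_assoc[symmetric] permutes_inv_o[OF s(1)] comp_id)
    moreover have "(z \<circ> s, inv s) \<in> {y \<in> box d N. strictly_decreasing d y} \<times> {s. s permutes {1..d}}"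
      using s z box_permute[OF s(1)] permutes_inv[OF s(1)] by simp
    ultimately show "z \<in> (\<lambda>(y, s). y \<circ> s) ` ({y \<in> box d N. strictly_decreasing d y} \<times> {s. s permutes {1..d}})"
      by (rule image_eqI)
  qed
qed

lemma signed_sum_eq_sum_squares:
  "(\<Sum>p | p permutes {1..d}. sign p * int (card (Wprime r n d (toeplitz p)))) =
   (\<Sum>y | y \<in> box d (r * n) \<and> strictly_decreasing d y. alternant d r n y * alternant d r n y)"
proof -
  let ?Y = "box d (r * n)" and ?w = "wcount d r n" and ?P = "{p. p permutes {1..d}}"
  let ?D = "{y \<in> ?Y. strictly_decreasing d y}"
  have "(\<Sum>p\<in>?P. sign p * int (card (Wprime r n d (toeplitz p)))) =
      (\<Sum>p\<in>?P. \<Sum>z\<in>?Y. ?w (\<lambda>j. z j + int j) * (sign p * ?w (\<lambda>j. z j + int (p j))))"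
    by (intro sum.cong) (auto simp: card_Wprime_toeplitz sum_distrib_left mult_ac)
  also have "\<dots> = (\<Sum>z\<in>?Y. ?w (\<lambda>j. z j + int j) * alternant d r n z)"
    by (subst sum.swap) (simp add: alternant_def sum_distrib_left)
  \<comment> \<open>Repeated coordinates make the alternant vanish; the remaining \<open>z\<close>
    are written uniquely as a sorted vector followed by a permutation.\<close>
  also have "\<dots> = (\<Sum>z | z \<in> ?Y \<and> inj_on z {1..d}. ?w (\<lambda>j. z j + int j) * alternant d r n z)"
    using alternant_not_inj finite_box by (intro sum.mono_neutral_right) auto
  also have "\<dots> = (\<Sum>(y, s)\<in>?D \<times> ?P. ?w (\<lambda>j. (y \<circ> s) j + int j) * alternant d r n (y \<circ> s))"
    using sum.reindex_bij_betw[OF bij_betw_strictly_decreasing,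
        of "\<lambda>z. ?w (\<lambda>j. z j + int j) * alternant d r n z" d "r * n"]
    by (simp add: case_prod_beta)
  also have "\<dots> = (\<Sum>y\<in>?D. \<Sum>s\<in>?P. ?w (\<lambda>j. (y \<circ> s) j + int j) * alternant d r n (y \<circ> s))"
    by (rule sum.cartesian_product[symmetric])
  also have "\<dots> = (\<Sum>y\<in>?D. alternant d r n y * alternant d r n y)"
  proof (rule sum.cong[OF refl])
    fix y
    \<comment> \<open>Antisymmetry takes \<open>alternant d r n y\<close> out with the sign of
      \<open>s\<close>, and symmetry of \<open>wcount\<close> moves \<open>s\<close> onto the shift
      as its inverse. Summing over \<open>s\<close> rebuilds a second alternant at
      \<open>y\<close>.\<close>
    have "(\<Sum>s\<in>?P. ?w (\<lambda>j. (y \<circ> s) j + int j) * alternant d r n (y \<circ> s)) =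
        (\<Sum>s\<in>?P. alternant d r n y * (sign (inv s) * ?w (\<lambda>j. y j + int (inv s j))))"
    proof (rule sum.cong[OF refl])
      fix s assume "s \<in> ?P"
      then have s: "s permutes {1..d}" by simp
      have "?w (\<lambda>j. (y \<circ> s) j + int j) = ?w ((\<lambda>j. y j + int (inv s j)) \<circ> s)"
        using permutes_inverses(2)[OF s] by (simp add: o_def)
      also have "\<dots> = ?w (\<lambda>j. y j + int (inv s j))" using s by (rule wcount_permute)
      finally show "?w (\<lambda>j. (y \<circ> s) j + int j) * alternant d r n (y \<circ> s) =
          alternant d r n y * (sign (inv s) * ?w (\<lambda>j. y j + int (inv s j)))"
        using alternant_permute[OF s, of r n y] sign_inverse[of s]
          permutes_imp_permutation[OF finite_atLeastAtMost s] by simp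
    qed
    also have "\<dots> = alternant d r n y * (\<Sum>s\<in>?P. sign s * ?w (\<lambda>j. y j + int (s j)))"
      unfolding sum_distrib_left[symmetric]
      using sum_permutations_inverse[of "\<lambda>s. sign s * ?w (\<lambda>j. y j + int (s j))" "{1..d}"] by simp
    finally show "(\<Sum>s\<in>?P. ?w (\<lambda>j. (y \<circ> s) j + int j) * alternant d r n (y \<circ> s)) =
        alternant d r n y * alternant d r n y"
      by (simp add: alternant_def)
  qed
  finally show ?thesis by simp
qed

lemma sum_squares_alternant:
  assumes d: "1 \<le> d"
  shows "(\<Sum>y | y \<in> box d N \<and> strictly_decreasing d y. alternant d r n y * alternant d r n y) =
    (\<Sum>l\<in>shapes d (Suc N). int (kostka d r n l * kostka d r n l))"
proof (rule sum.reindex_bij_witness[of _ "shifted d" "unshifted d"])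
  fix y assume "y \<in> {y. y \<in> box d N \<and> strictly_decreasing d y}"
  then have y: "y \<in> box d N" "strictly_decreasing d y" by auto
  have dec: "y (Suc j) + int (Suc j) \<le> y j + int j" if "1 \<le> j" "j < d" for j
    using y(2) that by (force simp: strictly_decreasing_def)
  have "0 \<le> y d + int d" using y(1) d by (auto simp: box_def dest!: PiE_mem[of _ _ _ d])
  \<comment> \<open>By \<open>dec\<close>, \<open>y j + j\<close> is weakly decreasing in
    \<open>j\<close>, so its nonnegativity at \<open>d\<close>, given by the box, spreads downwards
    to every index.\<close>
  have ge: "0 \<le> y j + int j" if "j \<in> {1..d}" for j
  proof -
    have "1 \<le> j" "j \<le> d" using that by auto
    from this(2,1) show ?thesis
    proof (induction j rule: inc_induct)
      case base
      show ?case by fact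
    next
      case (step j)
      then show ?case using dec[of j] by linarith
    qed
  qed
  have ext: "y \<in> extensional {1..d}" using y(1) by (auto simp: box_def PiE_def)
  show eq: "shifted d (unshifted d y) = y"
    using ext ge by (rule shifted_unshifted)
  have mono: "unshifted d y (Suc k) \<le> unshifted d y k" for k
    using dec[of "Suc k"] by (simp add: unshifted_def) linarith
  have z: "unshifted d y k = 0" if "d \<le> k" for k using that by (simp add: unshifted_def)
  \<comment> \<open>Coordinate 1 is the first part minus 1, so the bound \<open>N\<close> of the box
    becomes the bound \<open>Suc N\<close> on shapes.\<close>
  have "y 1 \<le> int N" using y(1) d by (auto simp: box_def dest!: PiE_mem[of _ _ _ 1])
  then show "unshifted d y \<in> shapes d (Suc N)"
    using mono z d by (simp add: shapes_def unshifted_def)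
  have "alternant d r n (shifted d (unshifted d y)) = int (kostka d r n (unshifted d y))"
    using d mono z by (rule alternant_shifted)
  then show "int (kostka d r n (unshifted d y) * kostka d r n (unshifted d y)) =
      alternant d r n y * alternant d r n y"
    by (simp add: eq)
next
  fix l assume l: "l \<in> shapes d (Suc N)"
  then show "unshifted d (shifted d l) = l"
    by (intro unshifted_shifted) (simp add: shapes_def)
  have "l k \<le> Suc N" for k
    using l lift_Suc_antimono_le[of l 0 k] by (simp add: shapes_def)
  then have le: "int (l k) \<le> int N + 1" for k by (metis of_nat_Suc of_nat_mono add.commute)
  have "shifted d l \<in> box d N"
    unfolding box_def
  proof (rule PiE_I)
    fix j assume j: "j \<in> {1..d}"
    then show "shifted d l j \<in> {- int d..int N}"
      using le[of "j - 1"] by (simp add: shifted_def)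
  qed (auto simp: shifted_def)
  moreover have "strictly_decreasing d (shifted d l)"
    using l by (intro strictly_decreasing_shifted) (simp add: shapes_def)
  ultimately show "shifted d l \<in> {y. y \<in> box d N \<and> strictly_decreasing d y}" by simp
qed

theorem theorem1:
  fixes n r d :: nat
  assumes "n \<ge> 1" "r \<ge> 1" "d \<ge> 1"
  shows "int (g r n d) =
    (\<Sum>\<pi> \<in> {\<pi>. \<pi> permutes {1..d}}. sign \<pi> * int (card (Wprime r n d (toeplitz \<pi>))))"
proof -
  \<comment> \<open>The bound \<open>Suc (r * n)\<close> is chosen to match the shapes arising from
    the box in \<open>sum_squares_alternant\<close>.\<close>
  have "int (g r n d) = (\<Sum>l\<in>shapes d (Suc (r * n)). int (kostka d r n l * kostka d r n l))"
    using g_eq_sum_kostka[of d r n "Suc (r * n)"] assms(3) by simp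
  then show ?thesis
    unfolding signed_sum_eq_sum_squares sum_squares_alternant[OF assms(3)] .
qed

end
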